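(* Let $R>0$ and let the Poincaré disk $D_P=\{w\in\mathbb C:|w|<1\}$ be endowed with the symplectic form $\omega_{D_P}=\dfrac{4R}{(1-|w|^2)^2}\,dw_{\rm r}\wedge dw_{\rm im}$ ($w=w_{\rm r}+iw_{\rm im}$) and with the Hamiltonian action of $G\cong SO(2,1)$ transported from the pseudo-sphere $P_R^+$ by the diffeomorphism $\psi_R:P_R^+\to D_P$, with moment map $J_{D_P}=\psi_R^{-1}:D_P\to\mathbf F\equiv\mathfrak g^*$. Then the set $\Omega$ of generalized temperatures is the set of time-like vectors of $\mathbf F\equiv\mathfrak g$ directed towards the past. Let $\boldsymbol\beta\in\Omega$ and let the admissible basis $(\mathbf e_x,\mathbf e_y,\mathbf e_z)$ of $\mathbf F$ used to define $\psi_R$ be chosen such that $\boldsymbol\beta=\beta\mathbf e_z$ with $\beta<0$. The probability density of the Gibbs state indexed by $\boldsymbol\beta$, with respect to the measure $d|w|\,d\varphi$ associated to the polar coordinates $(|w|,\varphi)$ on $D_P\setminus\{0\}$ ($w_{\rm r}=|w|\cos\varphi$, $w_{\rm im}=|w|\sin\varphi$), is $$\frac{2R|\beta|\,|w|}{\pi(1-|w|^2)^2}\exp\left(-\frac{2R|\beta|}{1-|w|^2}\right),$$ and its probability density with respect to the Liouville measure $\lambda_{\omega_{D_P}}$ is $$\rho_{\boldsymbol\beta}(w)=\frac{|\beta|}{2\pi}\exp\left(-\frac{2R|\beta|}{1-|w|^2}\right),\qquad w\in D_P.$$ The associated thermodynamic functions are, with $\Vert\boldsymbol\beta\Vert=\sqrt{-\boldsymbol\beta\cdot\boldsymbol\beta}=|\beta|$,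 $$E_J(\boldsymbol\beta)=-\frac{1+R\Vert\boldsymbol\beta\Vert}{\Vert\boldsymbol\beta\Vert^2}\,\boldsymbol\beta,\qquad S(\boldsymbol\beta)=1+\log\frac{2\pi}{\Vert\boldsymbol\beta\Vert}.$$
   Context: $\mathbf F$ is a three-dimensional real vector space endowed with a scalar product $\cdot$ of signature $(+,+,-)$, an orientation and a temporal orientation (choice of one of the two connected components of the set of non-zero vectors $\mathbf v$ with $\mathbf v\cdot\mathbf v\le0$; its elements are directed towards the future, those of the other component towards the past). Time-like means $\mathbf v\cdot\mathbf v<0$. An admissible basis is a positively oriented orthogonal basis with $\mathbf e_x\cdot\mathbf e_x=\mathbf e_y\cdot\mathbf e_y=1$, $\mathbf e_z\cdot\mathbf e_z=-1$, $\mathbf e_z$ directed towards the future. $G$ is the group of linear automorphisms of $\mathbf F$ preserving all these structures, $\mathfrak g$ its Lie algebra. $\mathbf F$ is identified with $\mathfrak g$ (the matrix of the endomorphism corresponding to $a\mathbf e_x+b\mathbf e_y+c\mathbf e_z$ being $\begin{pmatrix}0&-c&b\\ c&0&-a\\ b&-a&0\end{pmatrix}$ in any admissible basis), and with $\mathfrak g^*$ via the scalar product, so $\langle\mathbf r,\boldsymbol\beta\rangle=\mathbf r\cdot\boldsymbol\beta$; the adjoint and coadjoint actions become the natural action of $G$ on $\mathbf F$. $P_R^+=\{x\mathbf e_x+y\mathbf e_y+z\mathbf e_z: z=\sqrt{R^2+x^2+y^2}\}$ is a coadjoint orbit, with symplectic form $dz\wedge d\varphi$ ($\varphi$ the polar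 angle of $(x,y)$) and with the canonical injection into $\mathbf F\equiv\mathfrak g^*$ as moment map of the coadjoint action. Given an admissible basis, $\psi_R:P_R^+\to D_P$ is $\psi_R(x\mathbf e_x+y\mathbf e_y+\sqrt{R^2+x^2+y^2}\,\mathbf e_z)=\dfrac{x+iy}{R+\sqrt{R^2+x^2+y^2}}$, with inverse $\psi_R^{-1}(w)=\dfrac{R}{1-|w|^2}\bigl(2(w_{\rm r}\mathbf e_x+w_{\rm im}\mathbf e_y)+(1+|w|^2)\mathbf e_z\bigr)$; $\omega_{D_P}$ is the symplectic form for which $\psi_R$ is a symplectomorphism. The Liouville measure is $\lambda_{\omega_{D_P}}(dw)=\frac{4R}{(1-|w|^2)^2}dw_{\rm r}\,dw_{\rm im}=\frac{4R|w|}{(1-|w|^2)^2}d|w|\,d\varphi$. Definitions (for a moment map $J:M\to\mathfrak g^*$ on a symplectic manifold $M$ with Liouville measure $\lambda$): $\boldsymbol\beta\in\mathfrak g$ is a generalized temperature if there exist an open neighbourhood $U$ of $\boldsymbol\beta$ in $\mathfrak g$ and a $\lambda$-integrable function $f:M\to\mathbb R^+$ with $\exp(-\langle J(x),\boldsymbol\beta'\rangle)\le f(x)$ for all $\boldsymbol\beta'\in U$, $x\in M$. $\Omega$ is the set of generalized temperatures. For $\boldsymbol\beta\in\Omega$: $P(\boldsymbol\beta)=\int_M\exp(-\langle J(x),\boldsymbol\beta\rangle)\lambda(dx)$; the Gibbs state indexed by $\boldsymbol\beta$ is the probability measure of density $\rho_{\boldsymbol\beta}(x)=P(\boldsymbol\beta)^{-1}\exp(-\langle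 J(x),\boldsymbol\beta\rangle)$ with respect to $\lambda$; $E_J(\boldsymbol\beta)=\int_M J\rho_{\boldsymbol\beta}\,d\lambda\in\mathfrak g^*$ (mean value of the moment map); $S(\boldsymbol\beta)=-\int_M\rho_{\boldsymbol\beta}\log\rho_{\boldsymbol\beta}\,d\lambda$ (entropy).
   Formalization: Both printed Gibbs densities have total mass exp(-2R|β|) < 1, so they are not probability densities; the formal statement multiplies each by exp(2R|β|), i.e. the exponent is 2R|β| - 2R|β|/(1-|w|²). *)

theory Defs
  imports "HOL-Probability.Probability_Measure"
begin

section \<open>Oriented and time-oriented three-dimensional Minkowski space\<close>

text \<open>The space \<open>F\<close> is an arbitrary type \<^typ>\<open>'f::euclidean_space\<close> of dimension 3. The Euclidean
  structure only provides the canonical topology and Borel structure of a finite-dimensional real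
  vector space; the scalar product of \<open>F\<close> is a separate parameter \<open>sp\<close>.\<close>

definition is_basis :: "'f::euclidean_space ^ 3 \<Rightarrow> bool" where
  "is_basis b \<longleftrightarrow> inj (($) b) \<and> independent (range (($) b)) \<and> span (range (($) b)) = UNIV"

definition orthonormal_frame :: "('f::euclidean_space \<Rightarrow> 'f \<Rightarrow> real) \<Rightarrow> 'f ^ 3 \<Rightarrow> bool" where
  "orthonormal_frame sp e \<longleftrightarrow> is_basis e \<and> (\<forall>i j. i \<noteq> j \<longrightarrow> sp (e $ i) (e $ j) = 0) \<and>
     sp (e $ 1) (e $ 1) = 1 \<and> sp (e $ 2) (e $ 2) = 1 \<and> sp (e $ 3) (e $ 3) = - 1"

definition lorentz_product :: "('f::euclidean_space \<Rightarrow> 'f \<Rightarrow> real) \<Rightarrow> bool" where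
  "lorentz_product sp \<longleftrightarrow> bilinear sp \<and> (\<forall>u v. sp u v = sp v u) \<and> (\<exists>e. orthonormal_frame sp e)"

definition same_orientation :: "(('f::euclidean_space ^ 3) \<times> ('f ^ 3)) set" where
  "same_orientation = {(b, c). is_basis b \<and> is_basis c \<and>
     (\<exists>A :: real ^ 3 ^ 3. 0 < det A \<and> (\<forall>i. c $ i = (\<Sum>j\<in>UNIV. A $ i $ j *\<^sub>R b $ j)))}"

definition orientation :: "('f::euclidean_space ^ 3) set \<Rightarrow> bool" where
  "orientation Or \<longleftrightarrow> Or \<in> {b. is_basis b} // same_orientation"

definition causal_cone :: "('f::euclidean_space \<Rightarrow> 'f \<Rightarrow> real) \<Rightarrow> 'f set" where
  "causal_cone sp = {v. v \<noteq> 0 \<and> sp v v \<le> 0}"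

definition minkowski_space ::
    "('f::euclidean_space \<Rightarrow> 'f \<Rightarrow> real) \<Rightarrow> ('f ^ 3) set \<Rightarrow> 'f set \<Rightarrow> bool" where
  "minkowski_space sp Or Fut \<longleftrightarrow> DIM('f) = 3 \<and> lorentz_product sp \<and> orientation Or \<and>
     Fut \<in> components (causal_cone sp)"

definition past :: "('f::euclidean_space \<Rightarrow> 'f \<Rightarrow> real) \<Rightarrow> 'f set \<Rightarrow> 'f set" where
  "past sp Fut = causal_cone sp - Fut"

definition admissible_basis ::
    "('f::euclidean_space \<Rightarrow> 'f \<Rightarrow> real) \<Rightarrow> ('f ^ 3) set \<Rightarrow> 'f set \<Rightarrow> 'f ^ 3 \<Rightarrow> bool" where
  "admissible_basis sp Or Fut e \<longleftrightarrow> orthonormal_frame sp e \<and> e \<in> Or \<and> e $ 3 \<in> Fut"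

definition mnorm :: "('f::euclidean_space \<Rightarrow> 'f \<Rightarrow> real) \<Rightarrow> 'f \<Rightarrow> real" where
  "mnorm sp v = sqrt (- sp v v)"

definition time_like :: "('f::euclidean_space \<Rightarrow> 'f \<Rightarrow> real) \<Rightarrow> 'f \<Rightarrow> bool" where
  "time_like sp v \<longleftrightarrow> sp v v < 0"


section \<open>The symmetry group and its Lie algebra\<close>

definition isometry_group ::
    "('f::euclidean_space \<Rightarrow> 'f \<Rightarrow> real) \<Rightarrow> ('f ^ 3) set \<Rightarrow> 'f set \<Rightarrow> ('f \<Rightarrow> 'f) set" where
  "isometry_group sp Or Fut = {g. linear g \<and> bij g \<and> (\<forall>u v. sp (g u) (g v) = sp u v) \<and>
     (\<forall>b\<in>Or. (\<chi> i. g (b $ i)) \<in> Or) \<and> g ` Fut = Fut}"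

text \<open>The identification of \<open>F\<close> with the Lie algebra of the group: \<open>lie e X\<close> is the endomorphism
  with matrix \<open>((0, -c, b), (c, 0, -a), (b, -a, 0))\<close> in the frame \<open>e\<close> when
  \<open>X = a e\<^sub>1 + b e\<^sub>2 + c e\<^sub>3\<close>. In a frame which is orthonormal for \<open>sp\<close>, the coordinates of \<open>v\<close>
  are \<open>sp v e\<^sub>1\<close>, \<open>sp v e\<^sub>2\<close> and \<open>- sp v e\<^sub>3\<close>.\<close>

definition lie :: "('f::euclidean_space \<Rightarrow> 'f \<Rightarrow> real) \<Rightarrow> 'f ^ 3 \<Rightarrow> 'f \<Rightarrow> 'f \<Rightarrow> 'f" where
  "lie sp e X v =
    (let a = sp X (e $ 1); b = sp X (e $ 2); c = - sp X (e $ 3);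
         x = sp v (e $ 1); y = sp v (e $ 2); z = - sp v (e $ 3)
     in (- c * y + b * z) *\<^sub>R e $ 1 + (c * x - a * z) *\<^sub>R e $ 2 + (b * x - a * y) *\<^sub>R e $ 3)"


section \<open>The pseudo-sphere and the Poincare disk\<close>

definition pseudo_sphere :: "real \<Rightarrow> 'f::euclidean_space ^ 3 \<Rightarrow> 'f set" where
  "pseudo_sphere R e =
    {x *\<^sub>R e $ 1 + y *\<^sub>R e $ 2 + z *\<^sub>R e $ 3 | x y z. z = sqrt (R\<^sup>2 + x\<^sup>2 + y\<^sup>2)}"

definition poincare_disk :: "complex set" where
  "poincare_disk = {w. cmod w < 1}"

definition psi ::
    "('f::euclidean_space \<Rightarrow> 'f \<Rightarrow> real) \<Rightarrow> 'f ^ 3 \<Rightarrow> real \<Rightarrow> 'f \<Rightarrow> complex" where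
  "psi sp e R v = (let x = sp v (e $ 1); y = sp v (e $ 2)
     in Complex x y / of_real (R + sqrt (R\<^sup>2 + x\<^sup>2 + y\<^sup>2)))"

text \<open>The moment map, with values in the dual of the Lie algebra identified with \<open>F\<close> through \<open>sp\<close>.\<close>

definition J_disk ::
    "('f::euclidean_space \<Rightarrow> 'f \<Rightarrow> real) \<Rightarrow> 'f ^ 3 \<Rightarrow> real \<Rightarrow> complex \<Rightarrow> 'f" where
  "J_disk sp e R = inv_into (pseudo_sphere R e) (psi sp e R)"

definition disk_action ::
    "('f::euclidean_space \<Rightarrow> 'f \<Rightarrow> real) \<Rightarrow> 'f ^ 3 \<Rightarrow> real \<Rightarrow> ('f \<Rightarrow> 'f) \<Rightarrow> complex \<Rightarrow> complex" where
  "disk_action sp e R g w = psi sp e R (g (J_disk sp e R w))"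

definition fundamental_field ::
    "('f::euclidean_space \<Rightarrow> 'f \<Rightarrow> real) \<Rightarrow> 'f ^ 3 \<Rightarrow> real \<Rightarrow> 'f \<Rightarrow> complex \<Rightarrow> complex" where
  "fundamental_field sp e R X w =
     frechet_derivative (psi sp e R) (at (J_disk sp e R w)) (lie sp e X (J_disk sp e R w))"

text \<open>A 2-form on an open subset of the plane is a function of a point and two tangent vectors.\<close>

definition omega_disk :: "real \<Rightarrow> complex \<Rightarrow> complex \<Rightarrow> complex \<Rightarrow> real" where
  "omega_disk R w u v = 4 * R / (1 - (cmod w)\<^sup>2)\<^sup>2 * (Re u * Im v - Re v * Im u)"

definition liouville_measure ::
    "complex set \<Rightarrow> (complex \<Rightarrow> complex \<Rightarrow> complex \<Rightarrow> real) \<Rightarrow> complex measure" where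
  "liouville_measure M \<omega> = density (restrict_space lborel M) (\<lambda>w. ennreal \<bar>\<omega> w 1 \<i>\<bar>)"

definition liouville_disk :: "real \<Rightarrow> complex measure" where
  "liouville_disk R = liouville_measure poincare_disk (omega_disk R)"

text \<open>The measure \<open>d|w| d\<phi>\<close> on the punctured disk, as a measure on the disk which does not charge
  the origin.\<close>

definition polar_measure :: "complex measure" where
  "polar_measure =
     distr (restrict_space (lborel \<Otimes>\<^sub>M lborel) ({0<..<1} \<times> {0..<2 * pi}))
       (restrict_space borel poincare_disk) (\<lambda>(r, \<phi>). rcis r \<phi>)"


section \<open>The transported action is Hamiltonian with moment map \<open>J_disk\<close>\<close>

lemma frame_expansion:
  assumes "DIM('f::euclidean_space) = 3" "lorentz_product (sp :: 'f \<Rightarrow> 'f \<Rightarrow> real)" "orthonormal_frame sp e"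
  shows "v = sp v (e $ 1) *\<^sub>R e $ 1 + sp v (e $ 2) *\<^sub>R e $ 2 + (- sp v (e $ 3)) *\<^sub>R e $ 3"
proof -
  have bl: "bilinear sp"
    using assms(2) by (auto simp: lorentz_product_def)
  have r: "range (($) e) = {e $ 1, e $ 2, e $ 3}"
    by (simp add: UNIV_3)
  have "v \<in> span {e $ 1, e $ 2, e $ 3}"
    using assms(3) r by (auto simp: orthonormal_frame_def is_basis_def)
  then obtain x y z where "v - x *\<^sub>R e $ 1 - y *\<^sub>R e $ 2 - z *\<^sub>R e $ 3 = 0"
    by (auto simp: span_breakdown_eq)
  hence v: "v = x *\<^sub>R e $ 1 + y *\<^sub>R e $ 2 + z *\<^sub>R e $ 3"
    by (simp add: algebra_simps)
  have o: "sp (e$1) (e$1) = 1" "sp (e$2) (e$2) = 1" "sp (e$3) (e$3) = -1"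
     "sp (e$1) (e$2) = 0" "sp (e$1) (e$3) = 0" "sp (e$2) (e$3) = 0"
     "sp (e$2) (e$1) = 0" "sp (e$3) (e$1) = 0" "sp (e$3) (e$2) = 0"
    using assms(3) by (auto simp: orthonormal_frame_def)
  show ?thesis
    by (simp add: v bilinear_ladd[OF bl] bilinear_lmul[OF bl] o)
qed

lemma frame_product:
  assumes "lorentz_product sp" "orthonormal_frame sp e"
  shows "sp (x *\<^sub>R e $ 1 + y *\<^sub>R e $ 2 + z *\<^sub>R e $ 3) (x' *\<^sub>R e $ 1 + y' *\<^sub>R e $ 2 + z' *\<^sub>R e $ 3)
    = x * x' + y * y' - z * z'"
proof -
  have bl: "bilinear sp" 
    using assms(1) by (auto simp: lorentz_product_def)
  have o: "sp (e$1) (e$1) = 1" "sp (e$2) (e$2) = 1" "sp (e$3) (e$3) = -1"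
     "sp (e$1) (e$2) = 0" "sp (e$1) (e$3) = 0" "sp (e$2) (e$3) = 0"
     "sp (e$2) (e$1) = 0" "sp (e$3) (e$1) = 0" "sp (e$3) (e$2) = 0"
    using assms(2) by (auto simp: orthonormal_frame_def)
  show ?thesis
    by (simp add: bilinear_ladd[OF bl] bilinear_lmul[OF bl] bilinear_radd[OF bl] bilinear_rmul[OF bl] o)
qed

lemma frame_product1:
  assumes "lorentz_product sp" "orthonormal_frame sp e"
  shows "sp (x *\<^sub>R e $ 1 + y *\<^sub>R e $ 2 + z *\<^sub>R e $ 3) (e $ 1) = x"
   "sp (x *\<^sub>R e $ 1 + y *\<^sub>R e $ 2 + z *\<^sub>R e $ 3) (e $ 2) = y"
   "sp (x *\<^sub>R e $ 1 + y *\<^sub>R e $ 2 + z *\<^sub>R e $ 3) (e $ 3) = - z"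
  using frame_product[OF assms, of x y z 1 0 0] frame_product[OF assms, of x y z 0 1 0]
    frame_product[OF assms, of x y z 0 0 1] by auto

lemma sqrt_aux:
  assumes R: "R > 0" and w: "cmod w < 1"
  shows "sqrt (R\<^sup>2 + (2 * R * Re w / (1 - (cmod w)\<^sup>2))\<^sup>2 + (2 * R * Im w / (1 - (cmod w)\<^sup>2))\<^sup>2)
     = R * (1 + (cmod w)\<^sup>2) / (1 - (cmod w)\<^sup>2)"
proof -
  define n where "n = (cmod w)\<^sup>2"
  have n: "n < 1" "n \<ge> 0" using w by (auto simp: n_def abs_square_less_1)
  have nn: "(Re w)\<^sup>2 + (Im w)\<^sup>2 = n" by (simp add: n_def cmod_power2)
  have "R\<^sup>2 + (2 * R * Re w / (1 - n))\<^sup>2 + (2 * R * Im w / (1 - n))\<^sup>2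
     = R\<^sup>2 + 4 * R\<^sup>2 * ((Re w)\<^sup>2 + (Im w)\<^sup>2) / (1 - n)\<^sup>2"
    by (simp add: power_divide power_mult_distrib add_divide_distrib algebra_simps)
  also have "\<dots> = (R * (1 + n) / (1 - n))\<^sup>2"
    unfolding nn using n by (simp add: divide_simps power2_eq_square) (simp add: algebra_simps)
  finally show ?thesis using n R by (simp add: n_def [symmetric])
qed

lemma psi_inj:
  assumes "lorentz_product sp" "orthonormal_frame sp e" "R > 0"
  shows "inj_on (psi sp e R) (pseudo_sphere R e)"
proof (rule inj_onI)
  fix u v assume u: "u \<in> pseudo_sphere R e" and v: "v \<in> pseudo_sphere R e" and eq: "psi sp e R u = psi sp e R v"
  obtain x y where u: "u = x *\<^sub>R e $ 1 + y *\<^sub>R e $ 2 + sqrt (R\<^sup>2 + x\<^sup>2 + y\<^sup>2) *\<^sub>R e $ 3"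
    using u by (auto simp: pseudo_sphere_def)
  obtain x' y' where v: "v = x' *\<^sub>R e $ 1 + y' *\<^sub>R e $ 2 + sqrt (R\<^sup>2 + x'\<^sup>2 + y'\<^sup>2) *\<^sub>R e $ 3"
    using v by (auto simp: pseudo_sphere_def)
  define z where "z = sqrt (R\<^sup>2 + x\<^sup>2 + y\<^sup>2)"
  define z' where "z' = sqrt (R\<^sup>2 + x'\<^sup>2 + y'\<^sup>2)"
  have z: "z\<^sup>2 = R\<^sup>2 + x\<^sup>2 + y\<^sup>2" "z \<ge> 0" by (auto simp: z_def)
  have z': "z'\<^sup>2 = R\<^sup>2 + x'\<^sup>2 + y'\<^sup>2" "z' \<ge> 0" by (auto simp: z'_def)
  have e0: "Complex x y / of_real (R + z) = Complex x' y' / of_real (R + z')"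
    using eq unfolding psi_def Let_def u v frame_product1[OF assms(1,2)] z_def z'_def .
  have e1: "x / (R + z) = x' / (R + z')"
    using arg_cong[OF e0, of Re] by simp
  have e2: "y / (R + z) = y' / (R + z')"
    using arg_cong[OF e0, of Im] by simp
  have q: "(x / (R + z))\<^sup>2 + (y / (R + z))\<^sup>2 = 1 - 2 * R / (R + z)" if "z\<^sup>2 = R\<^sup>2 + x\<^sup>2 + y\<^sup>2" "z \<ge> 0" for x y z :: real
  proof -
    have "(x / (R + z))\<^sup>2 + (y / (R + z))\<^sup>2 = (z\<^sup>2 - R\<^sup>2) / (R + z)\<^sup>2"
      using that by (simp add: power_divide add_divide_distrib[symmetric])
    also have "\<dots> = 1 - 2 * R / (R + z)"
      using \<open>R > 0\<close> that(2) by (simp add: divide_simps power2_eq_square) (simp add: algebra_simps)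
    finally show ?thesis .
  qed
  have "2 * R / (R + z) = 2 * R / (R + z')"
    using q[OF z] q[OF z'] unfolding e1 e2 by linarith
  hence "z' = z" using \<open>R > 0\<close> z(2) z'(2) by (auto simp: frac_eq_eq)
  moreover have "R + z \<noteq> 0" using \<open>R > 0\<close> z by simp
  ultimately have "x = x'" "y = y'" using e1 e2 by auto
  thus "u = v" using u v by simp
qed

lemma J_disk_eq:
  assumes "lorentz_product sp" "orthonormal_frame sp e" "R > 0" "w \<in> poincare_disk"
  shows "J_disk sp e R w = (R / (1 - (cmod w)\<^sup>2)) *\<^sub>R
    ((2 * Re w) *\<^sub>R e $ 1 + (2 * Im w) *\<^sub>R e $ 2 + (1 + (cmod w)\<^sup>2) *\<^sub>R e $ 3)" (is "_ = ?v")
    and "J_disk sp e R w \<in> pseudo_sphere R e" and "psi sp e R (J_disk sp e R w) = w"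
proof -
  define n where "n = (cmod w)\<^sup>2"
  define x where "x = 2 * R * Re w / (1 - n)"
  define y where "y = 2 * R * Im w / (1 - n)"
  have w: "cmod w < 1" using assms(4) by (simp add: poincare_disk_def)
  have n: "n < 1" "n \<ge> 0" using w by (auto simp: n_def abs_square_less_1)
  have s: "sqrt (R\<^sup>2 + x\<^sup>2 + y\<^sup>2) = R * (1 + n) / (1 - n)"
    using sqrt_aux[OF assms(3) w] by (simp add: x_def y_def n_def)
  have v: "?v = x *\<^sub>R e $ 1 + y *\<^sub>R e $ 2 + sqrt (R\<^sup>2 + x\<^sup>2 + y\<^sup>2) *\<^sub>R e $ 3"
    unfolding s unfolding x_def y_def n_def[symmetric] by (simp add: scaleR_add_right mult_ac)
  have mem: "?v \<in> pseudo_sphere R e"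
    unfolding v pseudo_sphere_def by blast
  have d: "R + R * (1 + n) / (1 - n) = 2 * R / (1 - n)"
    using n by (simp add: divide_simps) (simp add: algebra_simps)
  have p: "psi sp e R ?v = w"
    unfolding v psi_def Let_def frame_product1[OF assms(1,2)] unfolding s d
    using n assms(3) by (simp add: complex_eq_iff x_def y_def)
  show "J_disk sp e R w = ?v"
    unfolding J_disk_def using inv_into_f_f[OF psi_inj[OF assms(1-3)] mem] p by simp
  thus "J_disk sp e R w \<in> pseudo_sphere R e" and "psi sp e R (J_disk sp e R w) = w"
    using mem p by auto
qed


lemma psi_derivative:
  fixes sp :: "'f::euclidean_space \<Rightarrow> 'f \<Rightarrow> real" and e :: "'f ^ 3"
  assumes "lorentz_product sp" "R > 0"
  defines "s \<equiv> \<lambda>v. sqrt (R\<^sup>2 + (sp v (e $ 1))\<^sup>2 + (sp v (e $ 2))\<^sup>2)"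
  shows "(psi sp e R has_derivative (\<lambda>h. Complex (sp h (e $ 1)) (sp h (e $ 2)) / of_real (R + s v) -
     psi sp e R v * of_real ((sp v (e $ 1) * sp h (e $ 1) + sp v (e $ 2) * sp h (e $ 2)) / (s v * (R + s v))))) (at v)"
proof -
  have bl: "bilinear sp" using assms(1) by (auto simp: lorentz_product_def)
  have lin: "bounded_linear (\<lambda>v. sp v c)" for c
    using bl by (auto simp: bilinear_def intro: linear_conv_bounded_linear[THEN iffD1])
  note d = bounded_linear.has_derivative[OF lin has_derivative_ident]
  have pos: "R\<^sup>2 + (sp v (e $ 1))\<^sup>2 + (sp v (e $ 2))\<^sup>2 > 0" 
    using assms(2) by (simp add: add_pos_nonneg)
  hence sv: "s v > 0" by (simp add: s_def)
  have ds: "(s has_derivative (\<lambda>h. (sp v (e $ 1) * sp h (e $ 1) + sp v (e $ 2) * sp h (e $ 2)) / s v)) (at v)"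
    unfolding s_def using pos by (auto intro!: derivative_eq_intros d simp: field_simps fun_eq_iff)
  have ps: "psi sp e R = (\<lambda>v. (of_real (sp v (e $ 1)) + \<i> * of_real (sp v (e $ 2))) / of_real (R + s v))"
    by (simp add: psi_def s_def fun_eq_iff Complex_eq Let_def)
  have nz: "complex_of_real R + complex_of_real (s v) \<noteq> 0"
    using sv assms(2) by (metis add_pos_pos of_real_add of_real_eq_0_iff less_irrefl)
  show ?thesis
    unfolding ps
    apply (rule has_derivative_eq_rhs)
     apply (rule derivative_intros has_derivative_of_real d ds)+
    subgoal using nz by simp
    subgoal using nz sv
      by (auto simp: fun_eq_iff Complex_eq divide_simps power2_eq_square) (auto simp: algebra_simps)
    done
qed

text \<open>Sign convention: the contraction of the symplectic form with the fundamental vector field of \<open>X\<close>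
  is the differential of the function \<open>w \<mapsto> sp (J w) X\<close>.\<close>

lemma J_disk_moment_map:
  fixes sp :: "'f::euclidean_space \<Rightarrow> 'f \<Rightarrow> real"
  assumes F: "DIM('f) = 3" "lorentz_product sp" "orthonormal_frame sp e" and R: "R > 0"
    and w: "w \<in> poincare_disk"
  shows "((\<lambda>w. sp (J_disk sp e R w) X) has_derivative
    omega_disk R w (fundamental_field sp e R X w)) (at w)"
proof -
  define a b c where "a = sp X (e $ 1)" and "b = sp X (e $ 2)" and "c = - sp X (e $ 3)"
  define n where "n = (cmod w)\<^sup>2"
  define p q where "p = Re w" and "q = Im w"
  have npq: "n = p\<^sup>2 + q\<^sup>2" by (simp add: n_def p_def q_def cmod_power2)
  have w1: "cmod w < 1" using w by (simp add: poincare_disk_def)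
  have n: "n < 1" "n \<ge> 0" using w1 by (auto simp: n_def abs_square_less_1)
  define x y z where "x = 2 * R * p / (1 - n)" and "y = 2 * R * q / (1 - n)" and "z = R * (1 + n) / (1 - n)"
  have J: "J_disk sp e R w = x *\<^sub>R e $ 1 + y *\<^sub>R e $ 2 + z *\<^sub>R e $ 3"
    unfolding J_disk_eq(1)[OF F(2,3) R w] by (simp add: scaleR_add_right mult_ac x_def y_def z_def p_def q_def n_def)
  have s: "sqrt (R\<^sup>2 + x\<^sup>2 + y\<^sup>2) = z"
    using sqrt_aux[OF R w1] by (simp add: x_def y_def z_def n_def p_def q_def)
  have z: "z > 0" using R n by (simp add: z_def)
  have Rz: "R + z = 2 * R / (1 - n)"
    using n by (simp add: z_def divide_simps) (simp add: algebra_simps)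
  have pr: "sp (J_disk sp e R w) (e $ 1) = x" "sp (J_disk sp e R w) (e $ 2) = y" "sp (J_disk sp e R w) (e $ 3) = - z"
    unfolding J by (rule frame_product1[OF F(2,3)])+
  define l where "l = lie sp e X (J_disk sp e R w)"
  have l: "sp l (e $ 1) = - c * y + b * z" "sp l (e $ 2) = c * x - a * z"
    unfolding l_def lie_def Let_def frame_product1[OF F(2,3)] pr by (simp_all add: a_def b_def c_def)
  have fd: "frechet_derivative (psi sp e R) (at (J_disk sp e R w)) = (\<lambda>h. Complex (sp h (e $ 1)) (sp h (e $ 2)) / of_real (R + z) -
     w * of_real ((x * sp h (e $ 1) + y * sp h (e $ 2)) / (z * (R + z))))"
    using frechet_derivative_at[OF psi_derivative[OF F(2) R, of e "J_disk sp e R w"]]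
    unfolding pr s J_disk_eq(3)[OF F(2,3) R w] by simp
  have k: "x / (R + z) = p" "y / (R + z) = q" "z / (R + z) = (1 + n) / 2"
    unfolding Rz using R n by (auto simp: x_def y_def z_def divide_simps)
  have t: "(x * (- c * y + b * z) + y * (c * x - a * z)) / (z * (R + z)) = b * p - a * q"
    using z R by (simp add: k[symmetric] divide_simps) (simp add: algebra_simps)
  have ff: "fundamental_field sp e R X w = 
     Complex (- c * y + b * z) (c * x - a * z) / of_real (R + z) - w * of_real (b * p - a * q)"
    unfolding fundamental_field_def fd l_def[symmetric] l t ..
  have ff: "Re (fundamental_field sp e R X w) = - c * q + b * (1 + n) / 2 - p * (b * p - a * q)"
     "Im (fundamental_field sp e R X w) = c * p - a * (1 + n) / 2 - q * (b * p - a * q)"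
    unfolding ff using k by (auto simp: p_def[symmetric] q_def[symmetric] add_divide_distrib diff_divide_distrib
       simp flip: times_divide_eq_right)
  have X: "X = a *\<^sub>R e $ 1 + b *\<^sub>R e $ 2 + c *\<^sub>R e $ 3"
    unfolding a_def b_def c_def by (rule frame_expansion[OF F])
  have JX: "sp (J_disk sp e R v) X = R / (1 - ((Re v)\<^sup>2 + (Im v)\<^sup>2)) * (2 * a * Re v + 2 * b * Im v - c * (1 + ((Re v)\<^sup>2 + (Im v)\<^sup>2)))" 
    if "v \<in> poincare_disk" for v
  proof -
    let ?r = "R / (1 - (cmod v)\<^sup>2)"
    have "J_disk sp e R v = (?r * (2 * Re v)) *\<^sub>R e $ 1 + (?r * (2 * Im v)) *\<^sub>R e $ 2 + (?r * (1 + (cmod v)\<^sup>2)) *\<^sub>R e $ 3"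
      unfolding J_disk_eq(1)[OF F(2,3) R that] by (simp add: scaleR_add_right)
    hence "sp (J_disk sp e R v) X = ?r * (2 * Re v) * a + ?r * (2 * Im v) * b - ?r * (1 + (cmod v)\<^sup>2) * c"
      using frame_product[OF F(2,3)] X by metis
    thus ?thesis unfolding cmod_power2 by (simp add: right_diff_distrib distrib_left add_divide_distrib mult_ac)
  qed
  have ob: "open poincare_disk"
    unfolding poincare_disk_def by (intro open_Collect_less continuous_intros)
  have nz: "1 - ((Re w)\<^sup>2 + (Im w)\<^sup>2) \<noteq> 0" using n npq by (simp add: p_def q_def)
  have "((\<lambda>v. R / (1 - ((Re v)\<^sup>2 + (Im v)\<^sup>2)) * (2 * a * Re v + 2 * b * Im v - c * (1 + ((Re v)\<^sup>2 + (Im v)\<^sup>2))))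
     has_derivative omega_disk R w (fundamental_field sp e R X w)) (at w)"
    apply (rule has_derivative_eq_rhs)
     apply (rule derivative_intros nz)+
    apply (rule ext)
    unfolding omega_disk_def ff n_def[symmetric] p_def[symmetric] q_def[symmetric]
    using n unfolding npq
    apply (simp add: divide_simps power2_eq_square)
    apply (simp add: algebra_simps)
    done
  thus ?thesis
    by (rule has_derivative_transform_within_open[OF _ ob w]) (simp add: JX)
qed


lemma future_product_neg:
  fixes sp :: "'f::euclidean_space \<Rightarrow> 'f \<Rightarrow> real"
  assumes F: "minkowski_space sp Or Fut" and e: "admissible_basis sp Or Fut e" and v: "v \<in> Fut"
  shows "sp v (e $ 3) < 0"
proof (rule ccontr)
  assume "\<not> sp v (e $ 3) < 0"
  have F': "DIM('f) = 3" "lorentz_product sp" "orthonormal_frame sp e" and C: "Fut \<in> components (causal_cone sp)"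
    and e3: "e $ 3 \<in> Fut"
    using F e by (auto simp: minkowski_space_def admissible_basis_def)
  have lin: "linear (\<lambda>v. sp v (e $ 3))"
    using F'(2) by (auto simp: lorentz_product_def bilinear_def)
  have "connected ((\<lambda>v. sp v (e $ 3)) ` Fut)"
    using C lin by (intro connected_continuous_image linear_continuous_on)
      (auto simp: linear_conv_bounded_linear in_components_connected)
  moreover have "sp (e $ 3) (e $ 3) = -1" using F'(3) by (simp add: orthonormal_frame_def)
  ultimately have "0 \<in> (\<lambda>v. sp v (e $ 3)) ` Fut"
    using connectedD_interval[of "(\<lambda>v. sp v (e $ 3)) ` Fut" "-1" "sp v (e $ 3)" 0] v e3 \<open>\<not> sp v (e $ 3) < 0\<close>
    by (metis imageI neg_le_0_iff_le not_less zero_le_one)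
  then obtain u where u: "u \<in> Fut" "sp u (e $ 3) = 0" by auto
  have cu: "u \<noteq> 0" "sp u u \<le> 0" using in_components_subset[OF C] u by (auto simp: causal_cone_def)
  obtain x y where xy: "u = x *\<^sub>R e $ 1 + y *\<^sub>R e $ 2 + 0 *\<^sub>R e $ 3"
    using frame_expansion[OF F', of u] u(2) by auto
  hence "x\<^sup>2 + y\<^sup>2 \<le> 0"
    using frame_product[OF F'(2,3), of x y 0 x y 0] cu(2) by (simp add: power2_eq_square)
  hence "x = 0" "y = 0" using sum_power2_le_zero_iff by blast+
  thus False using xy cu by simp
qed

lemma psi_in_disk:
  assumes "lorentz_product sp" "orthonormal_frame sp e" "R > 0" "v \<in> pseudo_sphere R e"
  shows "psi sp e R v \<in> poincare_disk"
proof -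
  obtain x y where v: "v = x *\<^sub>R e $ 1 + y *\<^sub>R e $ 2 + sqrt (R\<^sup>2 + x\<^sup>2 + y\<^sup>2) *\<^sub>R e $ 3"
    using assms(4) by (auto simp: pseudo_sphere_def)
  have "sqrt (x\<^sup>2 + y\<^sup>2) \<le> sqrt (R\<^sup>2 + x\<^sup>2 + y\<^sup>2)" by simp
  hence "cmod (Complex x y) < R + sqrt (R\<^sup>2 + x\<^sup>2 + y\<^sup>2)" using assms(3) unfolding cmod_def complex.sel by linarith
  moreover have "R + sqrt (R\<^sup>2 + x\<^sup>2 + y\<^sup>2) > 0" using assms(3) by (simp add: add_pos_nonneg)
  ultimately show ?thesis
    unfolding v psi_def Let_def frame_product1[OF assms(1,2)] poincare_disk_def
    by (simp add: norm_divide del: of_real_add)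
qed

lemma pseudo_sphere_future:
  assumes F: "minkowski_space sp Or Fut" and e: "admissible_basis sp Or Fut e"
    and R: "R > 0" and v: "v \<in> pseudo_sphere R e"
  shows "v \<in> Fut"
proof -
  have F': "lorentz_product sp" "orthonormal_frame sp e" and C: "Fut \<in> components (causal_cone sp)"
    and e3: "e $ 3 \<in> Fut"
    using F e by (auto simp: minkowski_space_def admissible_basis_def)
  obtain x y z where v: "v = x *\<^sub>R e $ 1 + y *\<^sub>R e $ 2 + z *\<^sub>R e $ 3"
    and z: "z = sqrt (R\<^sup>2 + x\<^sup>2 + y\<^sup>2)"
    using v by (auto simp: pseudo_sphere_def)
  have z0: "z > 0" and z2: "z\<^sup>2 = R\<^sup>2 + x\<^sup>2 + y\<^sup>2" using R by (auto simp: z add_pos_nonneg)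
  have "closed_segment (e $ 3) v \<subseteq> causal_cone sp"
  proof
    fix u assume "u \<in> closed_segment (e $ 3) v"
    then obtain t where t: "0 \<le> t" "t \<le> 1" and "u = (1 - t) *\<^sub>R e $ 3 + t *\<^sub>R v"
      by (auto simp: in_segment)
    hence u: "u = (t * x) *\<^sub>R e $ 1 + (t * y) *\<^sub>R e $ 2 + ((1 - t) + t * z) *\<^sub>R e $ 3"
      unfolding v by (simp add: algebra_simps)
    have pos: "(1 - t) + t * z > 0" 
      using t z0 by (cases "t = 0") (auto intro: add_nonneg_pos)
    have "(t * x)\<^sup>2 + (t * y)\<^sup>2 \<le> (t * z)\<^sup>2"
      unfolding power_mult_distrib z2 by (simp add: algebra_simps)
    also have "\<dots> \<le> ((1 - t) + t * z)\<^sup>2"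
      using t z0 by (intro power_mono) auto
    finally have "sp u u \<le> 0" unfolding u frame_product[OF F'] by (simp add: power2_eq_square)
    moreover have "sp u (e $ 3) \<noteq> 0" unfolding u frame_product1[OF F'] using pos by simp
    hence "u \<noteq> 0" using F'(1) by (auto simp: lorentz_product_def bilinear_lzero)
    ultimately show "u \<in> causal_cone sp" by (simp add: causal_cone_def)
  qed
  hence "closed_segment (e $ 3) v \<subseteq> Fut"
    using e3 by (intro components_maximal[OF C]) auto
  thus ?thesis by auto
qed

lemma J_disk_equivariant:
  fixes sp :: "'f::euclidean_space \<Rightarrow> 'f \<Rightarrow> real"
  assumes F: "minkowski_space sp Or Fut" and e: "admissible_basis sp Or Fut e"
    and R: "R > 0" and g: "g \<in> isometry_group sp Or Fut" and w: "w \<in> poincare_disk"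
  shows "disk_action sp e R g w \<in> poincare_disk"
    and "J_disk sp e R (disk_action sp e R g w) = g (J_disk sp e R w)"
proof -
  have F': "DIM('f) = 3" "lorentz_product sp" "orthonormal_frame sp e"
    using F e by (auto simp: minkowski_space_def admissible_basis_def)
  note J = J_disk_eq[OF F'(2,3) R w]
  obtain x y z where Jz: "J_disk sp e R w = x *\<^sub>R e $ 1 + y *\<^sub>R e $ 2 + z *\<^sub>R e $ 3"
     "z = sqrt (R\<^sup>2 + x\<^sup>2 + y\<^sup>2)"
    using J(2) by (auto simp: pseudo_sphere_def)
  have g': "sp (g u) (g v) = sp u v" "g ` Fut = Fut" for u v using g by (auto simp: isometry_group_def)
  have z2: "z\<^sup>2 = R\<^sup>2 + x\<^sup>2 + y\<^sup>2" unfolding Jz(2) by simp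
  obtain x' y' z' where gz: "g (J_disk sp e R w) = x' *\<^sub>R e $ 1 + y' *\<^sub>R e $ 2 + z' *\<^sub>R e $ 3"
     using frame_expansion[OF F'] by blast
  have "x * x + y * y - z * z = x' * x' + y' * y' - z' * z'"
    using g'(1)[of "J_disk sp e R w" "J_disk sp e R w"]
    unfolding gz unfolding Jz(1) frame_product[OF F'(2,3)] by simp
  hence "z'\<^sup>2 = R\<^sup>2 + x'\<^sup>2 + y'\<^sup>2" using z2 by (simp add: power2_eq_square)
  moreover have "g (J_disk sp e R w) \<in> Fut" using g'(2) pseudo_sphere_future[OF F e R J(2)] by blast
  from future_product_neg[OF F e this] have "z' > 0"
    unfolding gz frame_product1[OF F'(2,3)] by simp
  ultimately have "z' = sqrt (R\<^sup>2 + x'\<^sup>2 + y'\<^sup>2)"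
    by (intro real_sqrt_unique[symmetric]) auto
  hence mem: "g (J_disk sp e R w) \<in> pseudo_sphere R e" using gz unfolding pseudo_sphere_def by blast
  show "J_disk sp e R (disk_action sp e R g w) = g (J_disk sp e R w)"
    unfolding disk_action_def using inv_into_f_f[OF psi_inj[OF F'(2,3) R] mem] by (simp add: J_disk_def)
  show "disk_action sp e R g w \<in> poincare_disk"
    unfolding disk_action_def by (rule psi_in_disk[OF F'(2,3) R mem])
qed


section \<open>Generalized temperatures, Gibbs states and thermodynamic functions\<close>

text \<open>Here \<open>L\<close> is the Liouville measure of a symplectic manifold \<open>M = space L\<close>, and \<open>J\<close> is a moment
  map; the pairing of the dual of the Lie algebra with the Lie algebra is \<open>sp\<close>.\<close>

definition generalized_temperatures ::
    "('f::euclidean_space \<Rightarrow> 'f \<Rightarrow> real) \<Rightarrow> 'm measure \<Rightarrow> ('m \<Rightarrow> 'f) \<Rightarrow> 'f set" where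
  "generalized_temperatures sp L J = {\<beta>. \<exists>U f. open U \<and> \<beta> \<in> U \<and> integrable L f \<and>
     (\<forall>x\<in>space L. 0 \<le> f x) \<and>
     (\<forall>\<beta>'\<in>U. \<forall>x\<in>space L. exp (- sp (J x) \<beta>') \<le> (f x :: real))}"

definition partition_function ::
    "('f::euclidean_space \<Rightarrow> 'f \<Rightarrow> real) \<Rightarrow> 'm measure \<Rightarrow> ('m \<Rightarrow> 'f) \<Rightarrow> 'f \<Rightarrow> real" where
  "partition_function sp L J \<beta> = (LINT x|L. exp (- sp (J x) \<beta>))"

definition gibbs_density ::
    "('f::euclidean_space \<Rightarrow> 'f \<Rightarrow> real) \<Rightarrow> 'm measure \<Rightarrow> ('m \<Rightarrow> 'f) \<Rightarrow> 'f \<Rightarrow> 'm \<Rightarrow> real" where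
  "gibbs_density sp L J \<beta> x = exp (- sp (J x) \<beta>) / partition_function sp L J \<beta>"

definition gibbs_state ::
    "('f::euclidean_space \<Rightarrow> 'f \<Rightarrow> real) \<Rightarrow> 'm measure \<Rightarrow> ('m \<Rightarrow> 'f) \<Rightarrow> 'f \<Rightarrow> 'm measure" where
  "gibbs_state sp L J \<beta> = density L (\<lambda>x. ennreal (gibbs_density sp L J \<beta> x))"

definition mean_moment ::
    "('f::euclidean_space \<Rightarrow> 'f \<Rightarrow> real) \<Rightarrow> 'm measure \<Rightarrow> ('m \<Rightarrow> 'f) \<Rightarrow> 'f \<Rightarrow> 'f" where
  "mean_moment sp L J \<beta> = (LINT x|L. gibbs_density sp L J \<beta> x *\<^sub>R J x)"

definition gibbs_entropy ::
    "('f::euclidean_space \<Rightarrow> 'f \<Rightarrow> real) \<Rightarrow> 'm measure \<Rightarrow> ('m \<Rightarrow> 'f) \<Rightarrow> 'f \<Rightarrow> real" where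
  "gibbs_entropy sp L J \<beta> =
     - (LINT x|L. gibbs_density sp L J \<beta> x * ln (gibbs_density sp L J \<beta> x))"

end

theory Submission
  imports Defs "HOL-Real_Asymp.Real_Asymp"
begin

text \<open>
  Write \<open>h w = R (1 + |w|\<^sup>2) / (1 - |w|\<^sup>2)\<close> for the third coordinate of \<open>J w\<close> (\<open>disk_height\<close>). The
  Liouville measure is \<open>dh d\<phi>\<close> in polar coordinates, because \<open>dh/dr = 4 R r / (1 - r\<^sup>2)\<^sup>2\<close>. For
  \<open>\<beta> = b e\<^sub>3\<close> with \<open>b < 0\<close> the pairing of \<open>J w\<close> with \<open>\<beta>\<close> is \<open>|b| h w\<close>. Hence under the Gibbs state
  \<open>h\<close> has the exponential law of rate \<open>|b|\<close> shifted to \<open>[R, \<infinity>)\<close>: its mass and mean are elementary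
  integrals (\<open>has_bochner_integral_height_exp\<close>), the entropy is minus the mean of the affine function
  \<open>ln \<rho> = ln (|b| / 2\<pi>) + |b| R - |b| h\<close>, and the mean of \<open>J\<close> has no component along \<open>e\<^sub>1\<close> and
  \<open>e\<^sub>2\<close> because those coordinates are odd functions of \<open>w\<close>.

  For a general \<open>\<beta>\<close> everything is decided by the sign of
  \<open>m \<beta> = \<beta>\<cdot>e\<^sub>3 - sqrt ((\<beta>\<cdot>e\<^sub>1)\<^sup>2 + (\<beta>\<cdot>e\<^sub>2)\<^sup>2)\<close> (\<open>past_margin\<close>), which is positive exactly on
  the past time-like vectors (\<open>timelike_past_iff\<close>). The pairing of \<open>J w\<close> with \<open>\<beta>\<close> is at least
  \<open>m \<beta> h w\<close> (\<open>pairing_J_disk_ge\<close>), so that \<open>m \<beta> > 0\<close> gives, on a neighbourhood of \<open>\<beta>\<close>, the integrable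
  bound \<open>exp (- m \<beta> h / 2)\<close>. If \<open>m \<beta> < 0\<close>, there is a boundary point of the disk near which the pairing
  tends to \<open>-\<infinity>\<close>, and the integral of \<open>exp (- J\<cdot>\<beta>)\<close> over small disks touching the boundary
  there is unbounded (\<open>nn_integral_J_disk_lower_bound\<close>). The borderline \<open>m \<beta> = 0\<close> is excluded because
  generalized temperatures form an open set. Finally, every past time-like vector is a
  negative multiple of the third vector of some admissible basis, obtained by a Lorentz boost
  (\<open>exists_admissible_basis_along\<close>).
\<close>

section \<open>Polar coordinates for the Lebesgue measure of the complex plane\<close>

lemma measurable_rcis [measurable (raw)]:
  assumes [measurable]: "g \<in> borel_measurable M" "h \<in> borel_measurable M"
  shows "(\<lambda>x. rcis (g x) (h x)) \<in> borel_measurable M"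
proof -
  have "(\<lambda>x. rcis (g x) (h x)) =
      (\<lambda>x. complex_of_real (g x * cos (h x)) + \<i> * complex_of_real (g x * sin (h x)))"
    by (auto simp: fun_eq_iff complex_eq_iff)
  then show ?thesis by simp
qed

lemma measurable_Complex [measurable (raw)]:
  "g \<in> borel_measurable M \<Longrightarrow> h \<in> borel_measurable M \<Longrightarrow>
    (\<lambda>x. Complex (g x) (h x)) \<in> borel_measurable M"
  unfolding Complex_eq by simp

lemma lborel_complex_eq:
  "(lborel :: complex measure) = distr (lborel \<Otimes>\<^sub>M lborel) borel (\<lambda>(x, y). Complex x y)"
proof (rule lborel_eqI)
  fix l u :: complex
  assume "\<And>b. b \<in> Basis \<Longrightarrow> l \<bullet> b \<le> u \<bullet> b"
  then have le: "Re l \<le> Re u" "Im l \<le> Im u"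
    using complex_inner_1_right[of l] by (force simp: Basis_complex_def)+
  have "(\<lambda>(x, y). Complex x y) -` box l u \<inter> space (lborel \<Otimes>\<^sub>M lborel)
      = {Re l<..<Re u} \<times> {Im l<..<Im u}"
    by (auto simp: box_def Basis_complex_def space_pair_measure)
  then have "emeasure (distr (lborel \<Otimes>\<^sub>M lborel) borel (\<lambda>(x, y). Complex x y)) (box l u)
      = ennreal (Re u - Re l) * ennreal (Im u - Im l)"
    using le by (subst emeasure_distr) (auto simp: lborel.emeasure_pair_measure_Times)
  also have "\<dots> = (\<Prod>b\<in>Basis. (u - l) \<bullet> b)"
    using le by (simp add: Basis_complex_def ennreal_mult'')
  finally show "emeasure (distr (lborel \<Otimes>\<^sub>M lborel) borel (\<lambda>(x, y). Complex x y)) (box l u)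
      = (\<Prod>b\<in>Basis. (u - l) \<bullet> b)" .
qed simp

text \<open>The substitution theorem for nonnegative integrals is about compact intervals; the
  open interval \<open>(-\<pi>/2, \<pi>/2)\<close> is exhausted by the intervals \<open>[- arctan n, arctan n]\<close>.\<close>

lemma nn_integral_tan_substitution:
  fixes f :: "real \<Rightarrow> ennreal"
  assumes [measurable]: "f \<in> borel_measurable borel"
  shows "(\<integral>\<^sup>+ t. f t \<partial>lborel) =
    (\<integral>\<^sup>+ \<phi>. f (tan \<phi>) * ennreal (inverse ((cos \<phi>)\<^sup>2)) * indicator {- (pi/2)<..<pi/2} \<phi> \<partial>lborel)"
proof -
  have up: "\<exists>n. t \<le> real (Suc n) \<and> - t \<le> real (Suc n)" for t
    by (metis abs_le_iff order_trans real_arch_simple of_nat_mono le_add2 plus_1_eq_Suc)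
  define A where "A n = {- real (Suc n)..real (Suc n)}" for n
  define B where "B n = {- arctan (real (Suc n))..arctan (real (Suc n))}" for n
  have incA: "incseq A" unfolding A_def by (auto simp: incseq_def)
  have incB: "incseq B" unfolding B_def incseq_def by (auto simp: arctan_le_iff
     intro: order_trans[rotated] dest: order_trans)
  have UA: "(\<Union>n. A n) = UNIV"
  proof safe
    fix t
    obtain n where "t \<le> real (Suc n)" "- t \<le> real (Suc n)" using up by blast
    then have "t \<in> A n" by (auto simp: A_def)
    then show "t \<in> (\<Union>n. A n)" by blast
  qed auto
  have "\<phi> \<in> (\<Union>n. B n)" if "\<phi> \<in> {- (pi/2)<..<pi/2}" for \<phi>
  proof -
    obtain n where "tan \<phi> \<le> real (Suc n)" "- tan \<phi> \<le> real (Suc n)" using up by blast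
    then have "arctan (tan \<phi>) \<le> arctan (real (Suc n))" "arctan (- tan \<phi>) \<le> arctan (real (Suc n))"
      by (simp_all add: arctan_le_iff)
    then have "\<phi> \<in> B n" using that by (auto simp: B_def arctan_tan arctan_minus)
    then show ?thesis by blast
  qed
  moreover have "B n \<subseteq> {- (pi/2)<..<pi/2}" for n
    using arctan_bounded[of "real (Suc n)"] by (auto simp: B_def)
  ultimately have UB: "(\<Union>n. B n) = {- (pi/2)<..<pi/2}" by blast
  let ?g = "\<lambda>\<phi>. f (tan \<phi>) * ennreal (inverse ((cos \<phi>)\<^sup>2))"
  have [measurable]: "A n \<in> sets borel" "B n \<in> sets borel" for n by (auto simp: A_def B_def)
  have [measurable]: "(tan :: real \<Rightarrow> real) \<in> borel_measurable borel"
    unfolding tan_def by measurable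
  have step: "(\<integral>\<^sup>+ t. f t * indicator (A n) t \<partial>lborel) = (\<integral>\<^sup>+ \<phi>. ?g \<phi> * indicator (B n) \<phi> \<partial>lborel)" for n
  proof -
    have c: "cos \<phi> > 0" if "\<phi> \<in> B n" for \<phi>
      using that UB by (intro cos_gt_zero_pi) auto
    have "arctan (real (Suc n)) > 0" by (simp only: zero_less_arctan_iff of_nat_0_less_iff zero_less_Suc)
    then have lt: "- arctan (real (Suc n)) < arctan (real (Suc n))" by linarith
    have "(\<integral>\<^sup>+ t. f t * indicator {tan (- arctan (real (Suc n)))..tan (arctan (real (Suc n)))} t \<partial>lborel)
      = (\<integral>\<^sup>+ \<phi>. ?g \<phi> * indicator (B n) \<phi> \<partial>lborel)"
      unfolding B_def
    proof (rule nn_integral_substitution_aux[OF _ _ _ _ _ lt])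
      fix \<phi> assume "\<phi> \<in> {- arctan (real (Suc n))..arctan (real (Suc n))}"
      then have "cos \<phi> > 0" using c by (simp add: B_def)
      then show "(tan has_real_derivative inverse ((cos \<phi>)\<^sup>2)) (at \<phi>)"
        by (intro DERIV_tan) auto
    next
      show "continuous_on {- arctan (real (Suc n))..arctan (real (Suc n))} (\<lambda>\<phi>. inverse ((cos \<phi>)\<^sup>2))"
        using c by (intro continuous_intros) (auto simp: B_def, fastforce)
    qed auto
    then show ?thesis by (simp add: A_def tan_arctan)
  qed
  have lim: "(\<integral>\<^sup>+ x. h x * indicator (\<Union>n. S n) x \<partial>lborel) = (SUP n. \<integral>\<^sup>+ x. h x * indicator (S n) x \<partial>lborel)"
    if [measurable]: "h \<in> borel_measurable borel" "\<And>n. S n \<in> sets borel" and inc: "incseq S"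
    for h :: "real \<Rightarrow> ennreal" and S :: "nat \<Rightarrow> real set"
  proof -
    have "emeasure (density lborel h) (\<Union>n. S n) = (SUP n. emeasure (density lborel h) (S n))"
      by (rule SUP_emeasure_incseq[symmetric]) (auto intro: inc)
    then show ?thesis by (simp add: emeasure_density)
  qed
  have "(\<integral>\<^sup>+ t. f t \<partial>lborel) = (\<integral>\<^sup>+ t. f t * indicator (\<Union>n. A n) t \<partial>lborel)" by (simp add: UA)
  also have "\<dots> = (SUP n. (\<integral>\<^sup>+ t. f t * indicator (A n) t \<partial>lborel))"
    by (rule lim) (auto simp: incA)
  also have "\<dots> = (SUP n. (\<integral>\<^sup>+ \<phi>. ?g \<phi> * indicator (B n) \<phi> \<partial>lborel))"
    by (simp only: step)
  also have "\<dots> = (\<integral>\<^sup>+ \<phi>. ?g \<phi> * indicator (\<Union>n. B n) \<phi> \<partial>lborel)"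
    by (rule lim[symmetric]) (auto simp: incB)
  finally show ?thesis by (simp add: UB)
qed


lemma rcis_uminus_radius: "rcis (- r) \<phi> = rcis r (\<phi> + pi)"
  by (simp add: complex_eq_iff)

lemma nn_integral_shift:
  fixes f :: "real \<Rightarrow> ennreal"
  assumes "f \<in> borel_measurable borel"
  shows "(\<integral>\<^sup>+ x. f x \<partial>lborel) = (\<integral>\<^sup>+ x. f (x + t) \<partial>lborel)"
  using nn_integral_real_affine[OF assms, of 1 t] by (simp add: add.commute)

text \<open>Only one-dimensional substitutions are used. For fixed \<open>x\<close> put \<open>y = x t\<close>, exchange the integrals,
  put \<open>t = tan \<phi>\<close>, and for fixed \<open>\<phi>\<close> put \<open>x = r cos \<phi>\<close>; the Jacobians multiply to
  \<open>|r cos \<phi>| * cos \<phi> / cos\<^sup>2 \<phi> = |r|\<close>. Here \<open>r\<close> ranges over all reals and \<open>\<phi>\<close> over a half turn; negative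
  radii are then traded for the opposite half turn. As \<open>ennreal\<close> maps negative reals to zero,
  the factor \<open>ennreal r\<close> already restricts the radius to \<open>r > 0\<close>.\<close>

lemma nn_integral_polar:
  fixes f :: "complex \<Rightarrow> ennreal"
  assumes [measurable]: "f \<in> borel_measurable borel"
  shows "(\<integral>\<^sup>+ w. f w \<partial>lborel) =
    (\<integral>\<^sup>+ \<phi>. (\<integral>\<^sup>+ r. ennreal r * f (rcis r \<phi>) \<partial>lborel) * indicator {0..<2 * pi} \<phi> \<partial>lborel)"
proof -
  define G where "G \<phi> = (\<integral>\<^sup>+ r. ennreal r * f (rcis r \<phi>) \<partial>lborel)" for \<phi>
  have [measurable]: "G \<in> borel_measurable borel" unfolding G_def by measurable
  have "(\<integral>\<^sup>+ w. f w \<partial>lborel) = (\<integral>\<^sup>+ p. f (case p of (x, y) \<Rightarrow> Complex x y) \<partial>(lborel \<Otimes>\<^sub>M lborel))"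
    by (subst lborel_complex_eq, subst nn_integral_distr) auto
  also have "\<dots> = (\<integral>\<^sup>+ x. \<integral>\<^sup>+ y. f (Complex x y) \<partial>lborel \<partial>lborel)"
    by (subst lborel.nn_integral_fst[symmetric]) auto
  also have "\<dots> = (\<integral>\<^sup>+ x. \<integral>\<^sup>+ t. ennreal \<bar>x\<bar> * f (Complex x (x * t)) \<partial>lborel \<partial>lborel)"
  proof (rule nn_integral_cong_AE)
    have "AE x in lborel. x \<noteq> (0::real)" by (rule AE_lborel_singleton)
    then show "AE x in lborel. (\<integral>\<^sup>+ y. f (Complex x y) \<partial>lborel)
        = (\<integral>\<^sup>+ t. ennreal \<bar>x\<bar> * f (Complex x (x * t)) \<partial>lborel)"
    proof eventually_elim
      case (elim x)
      show ?case
        using nn_integral_real_affine[of "\<lambda>y. f (Complex x y)" x 0] elim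
        by (simp add: nn_integral_cmult)
    qed
  qed
  also have "\<dots> = (\<integral>\<^sup>+ t. \<integral>\<^sup>+ x. ennreal \<bar>x\<bar> * f (Complex x (x * t)) \<partial>lborel \<partial>lborel)"
    by (rule lborel_pair.Fubini') measurable
  also have "\<dots> = (\<integral>\<^sup>+ \<phi>. (\<integral>\<^sup>+ x. ennreal \<bar>x\<bar> * f (Complex x (x * tan \<phi>)) \<partial>lborel)
      * ennreal (inverse ((cos \<phi>)\<^sup>2)) * indicator {- (pi/2)<..<pi/2} \<phi> \<partial>lborel)"
    by (rule nn_integral_tan_substitution) measurable
  also have "\<dots> = (\<integral>\<^sup>+ \<phi>. (G \<phi> + G (\<phi> + pi)) * indicator {- (pi/2)<..<pi/2} \<phi> \<partial>lborel)"
  proof (rule nn_integral_cong)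
    fix \<phi> :: real
    consider "\<phi> \<notin> {- (pi/2)<..<pi/2}" | "\<phi> \<in> {- (pi/2)<..<pi/2}" by blast
    then show "(\<integral>\<^sup>+ x. ennreal \<bar>x\<bar> * f (Complex x (x * tan \<phi>)) \<partial>lborel)
        * ennreal (inverse ((cos \<phi>)\<^sup>2)) * indicator {- (pi/2)<..<pi/2} \<phi>
      = (G \<phi> + G (\<phi> + pi)) * indicator {- (pi/2)<..<pi/2} \<phi>"
    proof cases
      case 2
      then have c: "cos \<phi> > 0" by (intro cos_gt_zero_pi) auto
      have e: "Complex (cos \<phi> * r) (cos \<phi> * (r * tan \<phi>)) = rcis r \<phi>" for r
        using c by (simp add: complex_eq_iff tan_def)
      have m: "ennreal \<bar>cos \<phi> * r\<bar> = ennreal (cos \<phi>) * ennreal \<bar>r\<bar>" for r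
        using c by (simp add: abs_mult ennreal_mult)
      have "(\<integral>\<^sup>+ x. ennreal \<bar>x\<bar> * f (Complex x (x * tan \<phi>)) \<partial>lborel)
          = ennreal (cos \<phi>) * (\<integral>\<^sup>+ r. ennreal (cos \<phi>) * (ennreal \<bar>r\<bar> * f (rcis r \<phi>)) \<partial>lborel)"
        using nn_integral_real_affine[of "\<lambda>x. ennreal \<bar>x\<bar> * f (Complex x (x * tan \<phi>))" "cos \<phi>" 0] c
        by (simp add: e m mult.assoc)
      also have "\<dots> = ennreal ((cos \<phi>)\<^sup>2) * (\<integral>\<^sup>+ r. ennreal \<bar>r\<bar> * f (rcis r \<phi>) \<partial>lborel)"
        using c by (subst nn_integral_cmult)
          (auto simp: power2_eq_square ennreal_mult mult.assoc)
      also have "(\<integral>\<^sup>+ r. ennreal \<bar>r\<bar> * f (rcis r \<phi>) \<partial>lborel)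
          = (\<integral>\<^sup>+ r. ennreal r * f (rcis r \<phi>) + ennreal (- r) * f (rcis r \<phi>) \<partial>lborel)"
        by (intro nn_integral_cong) (auto simp: abs_if ennreal_neg)
      also have "\<dots> = G \<phi> + (\<integral>\<^sup>+ r. ennreal (- r) * f (rcis r \<phi>) \<partial>lborel)"
        by (subst nn_integral_add) (auto simp: G_def)
      also have "(\<integral>\<^sup>+ r. ennreal (- r) * f (rcis r \<phi>) \<partial>lborel) = G (\<phi> + pi)"
        using nn_integral_real_affine[of "\<lambda>r. ennreal (- r) * f (rcis r \<phi>)" "-1" 0]
        by (simp add: G_def rcis_uminus_radius)
      finally have "(\<integral>\<^sup>+ x. ennreal \<bar>x\<bar> * f (Complex x (x * tan \<phi>)) \<partial>lborel)
        * ennreal (inverse ((cos \<phi>)\<^sup>2)) = (G \<phi> + G (\<phi> + pi)) * (ennreal ((cos \<phi>)\<^sup>2) * ennreal (inverse ((cos \<phi>)\<^sup>2)))"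
        by (simp add: mult_ac)
      also have "ennreal ((cos \<phi>)\<^sup>2) * ennreal (inverse ((cos \<phi>)\<^sup>2)) = 1"
        using c by (simp flip: ennreal_mult)
      finally show ?thesis by simp
    qed simp
  qed
  also have "\<dots> = (\<integral>\<^sup>+ \<phi>. G \<phi> * indicator {- (pi/2)<..<0} \<phi> + G \<phi> * indicator {0..<pi/2} \<phi>
      + G (\<phi> + pi) * indicator {- (pi/2)<..<pi/2} \<phi> \<partial>lborel)"
    by (intro nn_integral_cong) (auto simp: distrib_right split: split_indicator)
  also have "\<dots> = (\<integral>\<^sup>+ \<phi>. G \<phi> * indicator {- (pi/2)<..<0} \<phi> \<partial>lborel)
      + (\<integral>\<^sup>+ \<phi>. G \<phi> * indicator {0..<pi/2} \<phi> \<partial>lborel)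
      + (\<integral>\<^sup>+ \<phi>. G (\<phi> + pi) * indicator {- (pi/2)<..<pi/2} \<phi> \<partial>lborel)"
    by (simp add: nn_integral_add)
  also have "(\<integral>\<^sup>+ \<phi>. G (\<phi> + pi) * indicator {- (pi/2)<..<pi/2} \<phi> \<partial>lborel)
      = (\<integral>\<^sup>+ \<phi>. G \<phi> * indicator {pi/2<..<3*pi/2} \<phi> \<partial>lborel)"
    by (subst (2) nn_integral_shift[where t = pi])
       (auto intro!: nn_integral_cong split: split_indicator)
  also have "(\<integral>\<^sup>+ \<phi>. G \<phi> * indicator {- (pi/2)<..<0} \<phi> \<partial>lborel)
      = (\<integral>\<^sup>+ \<phi>. G \<phi> * indicator {3*pi/2<..<2*pi} \<phi> \<partial>lborel)"
  proof -
    have "G (\<phi> + 2 * pi) = G \<phi>" for \<phi>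
      by (simp add: G_def rcis_def cis_mult[symmetric])
    then show ?thesis
      by (subst (2) nn_integral_shift[where t = "2 * pi"])
         (auto intro!: nn_integral_cong split: split_indicator)
  qed
  also have "(\<integral>\<^sup>+ \<phi>. G \<phi> * indicator {3*pi/2<..<2*pi} \<phi> \<partial>lborel)
      + (\<integral>\<^sup>+ \<phi>. G \<phi> * indicator {0..<pi/2} \<phi> \<partial>lborel)
      + (\<integral>\<^sup>+ \<phi>. G \<phi> * indicator {pi/2<..<3*pi/2} \<phi> \<partial>lborel)
      = (\<integral>\<^sup>+ \<phi>. G \<phi> * indicator {3*pi/2<..<2*pi} \<phi> + G \<phi> * indicator {0..<pi/2} \<phi>
          + G \<phi> * indicator {pi/2<..<3*pi/2} \<phi> \<partial>lborel)"
    by (simp add: nn_integral_add)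
  also have "\<dots> = (\<integral>\<^sup>+ \<phi>. G \<phi> * indicator {0..<2 * pi} \<phi> \<partial>lborel)"
  proof (rule nn_integral_cong_AE)
    have "AE \<phi> in lborel. \<phi> \<noteq> pi/2" "AE \<phi> in lborel. \<phi> \<noteq> 3*pi/2"
      by (rule AE_lborel_singleton)+
    then show "AE \<phi> in lborel. G \<phi> * indicator {3*pi/2<..<2*pi} \<phi> + G \<phi> * indicator {0..<pi/2} \<phi>
          + G \<phi> * indicator {pi/2<..<3*pi/2} \<phi> = G \<phi> * indicator {0..<2 * pi} \<phi>"
    proof eventually_elim
      case (elim \<phi>)
      then show ?case using pi_gt_zero by (auto split: split_indicator)
    qed
  qed
  finally show ?thesis by (simp add: G_def)
qed

section \<open>The Liouville measure of the disk\<close>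

text \<open>The density is the derivative of the height \<open>R (1 + r\<^sup>2) / (1 - r\<^sup>2)\<close>, which increases from
  \<open>R\<close> to \<open>\<infinity>\<close> on \<open>(0, 1)\<close>: the composition of \<open>G\<close> with the height is a primitive of the integrand.\<close>

lemma nn_integral_height_substitution:
  fixes g G :: "real \<Rightarrow> real"
  assumes R: "R > 0"
    and G: "\<And>z. z \<ge> R \<Longrightarrow> (G has_real_derivative g z) (at z)"
    and g: "\<And>z. z \<ge> R \<Longrightarrow> isCont g z" "\<And>z. z \<ge> R \<Longrightarrow> g z \<ge> 0"
    and lim: "(G \<longlongrightarrow> l) at_top"
  shows "(\<integral>\<^sup>+ r. ennreal (4 * R * r / (1 - r\<^sup>2)\<^sup>2 * g (R * (1 + r\<^sup>2) / (1 - r\<^sup>2))) * indicator {0<..<1} r \<partial>lborel)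
    = ennreal (l - G R)"
proof -
  define h where "h r = R * (1 + r\<^sup>2) / (1 - r\<^sup>2)" for r :: real
  define d where "d r = 4 * R * r / (1 - r\<^sup>2)\<^sup>2" for r :: real
  have sq: "r\<^sup>2 < 1" if "0 \<le> r" "r < 1" for r :: real
    using that by (simp add: abs_square_less_1)
  have hR: "h r \<ge> R" if "0 \<le> r" "r < 1" for r
    using sq[OF that] R by (simp add: h_def divide_simps)
  have dh: "(h has_real_derivative d r) (at r)" if "0 \<le> r" "r < 1" for r
    unfolding h_def d_def using sq[OF that]
    by (auto intro!: derivative_eq_intros simp: divide_simps power2_eq_square)
       (simp add: algebra_simps)
  have DG: "((\<lambda>r. G (h r)) has_real_derivative d r * g (h r)) (at r)" if "0 \<le> r" "r < 1" for r
    using DERIV_chain2[OF G[OF hR[OF that]] dh[OF that]] by (simp add: mult.commute)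
  have cont: "isCont (\<lambda>r. d r * g (h r)) r" if "0 \<le> r" "r < 1" for r
  proof -
    have "isCont h r" using dh[OF that] DERIV_isCont by blast
    then have "isCont (\<lambda>r. g (h r)) r" using g(1)[OF hR[OF that]] by (rule isCont_o2)
    moreover have "isCont d r" unfolding d_def using sq[OF that] by (intro continuous_intros) auto
    ultimately show ?thesis by (intro continuous_intros)
  qed
  have nn: "d r * g (h r) \<ge> 0" if "0 \<le> r" "r < 1" for r
    using that R g(2)[OF hR[OF that]] by (simp add: d_def)
  have h0: "h 0 = R" by (simp add: h_def)
  have A: "(((\<lambda>r. G (h r)) \<circ> real_of_ereal) \<longlongrightarrow> G R) (at_right 0)"
  proof -
    have "isCont (\<lambda>r. G (h r)) 0" using DG[of 0] DERIV_isCont by auto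
    then have "((\<lambda>r. G (h r)) \<longlongrightarrow> G R) (at_right 0)"
      using filterlim_at_split h0 by (auto simp: isCont_def)
    then show ?thesis
      unfolding zero_ereal_def ereal_tendsto_simps1 .
  qed
  have B: "(((\<lambda>r. G (h r)) \<circ> real_of_ereal) \<longlongrightarrow> l) (at_left 1)"
  proof -
    have "filterlim h at_top (at_left 1)" unfolding h_def using R by real_asymp
    then have "((\<lambda>r. G (h r)) \<longlongrightarrow> l) (at_left 1)" using lim by (rule filterlim_compose[rotated])
    then show ?thesis unfolding one_ereal_def ereal_tendsto_simps1 .
  qed
  note I = interval_integral_FTC_nonneg[where a = 0 and b = 1 and F = "\<lambda>r. G (h r)" and f = "\<lambda>r. d r * g (h r)",
    OF _ _ _ _ A B]
  have e: "einterval 0 1 = {0<..<1}"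
    by (auto simp: einterval_def)
  have si: "set_integrable lborel {0<..<1} (\<lambda>r. d r * g (h r))" "(LBINT x=0..1. d x * g (h x)) = l - G R"
    using I DG cont nn by (auto simp: e)
  then have "(LINT r|lborel. indicator {0<..<1} r * (d r * g (h r))) = l - G R"
    "integrable lborel (\<lambda>r. indicator {0<..<1} r * (d r * g (h r)))"
    by (simp_all add: interval_lebesgue_integral_def e set_lebesgue_integral_def set_integrable_def)
  then have "(\<integral>\<^sup>+ r. ennreal (indicator {0<..<1} r * (d r * g (h r))) \<partial>lborel) = ennreal (l - G R)"
    using nn by (subst nn_integral_eq_integral) (auto split: split_indicator)
  also have "(\<integral>\<^sup>+ r. ennreal (indicator {0<..<1} r * (d r * g (h r))) \<partial>lborel)
     = (\<integral>\<^sup>+ r. ennreal (d r * g (h r)) * indicator {0<..<1} r \<partial>lborel)"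
    by (intro nn_integral_cong) (auto split: split_indicator)
  finally show ?thesis by (simp add: d_def h_def)
qed

lemma nn_integral_height_exp:
  fixes R k :: real
  assumes "R > 0" "k > 0"
  defines "h \<equiv> \<lambda>r. R * (1 + r\<^sup>2) / (1 - r\<^sup>2)"
  shows "(\<integral>\<^sup>+ r. ennreal (4 * R * r / (1 - r\<^sup>2)\<^sup>2 * exp (- k * h r)) * indicator {0<..<1} r \<partial>lborel)
      = ennreal (exp (- k * R) / k)"
    and "(\<integral>\<^sup>+ r. ennreal (4 * R * r / (1 - r\<^sup>2)\<^sup>2 * (h r * exp (- k * h r))) * indicator {0<..<1} r \<partial>lborel)
      = ennreal ((R + 1 / k) * exp (- k * R) / k)"
proof -
  have l1: "((\<lambda>z. - exp (- k * z) / k) \<longlongrightarrow> 0) at_top"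
    using assms by real_asymp
  show "(\<integral>\<^sup>+ r. ennreal (4 * R * r / (1 - r\<^sup>2)\<^sup>2 * exp (- k * h r)) * indicator {0<..<1} r \<partial>lborel)
      = ennreal (exp (- k * R) / k)"
    unfolding h_def using assms(2)
    by (subst nn_integral_height_substitution[OF assms(1) _ _ _ l1, where g = "\<lambda>z. exp (- k * z)"])
       (auto intro!: derivative_eq_intros continuous_intros)
  have l2: "((\<lambda>z. - (z + 1 / k) * exp (- k * z) / k) \<longlongrightarrow> 0) at_top"
    using assms by real_asymp
  show "(\<integral>\<^sup>+ r. ennreal (4 * R * r / (1 - r\<^sup>2)\<^sup>2 * (h r * exp (- k * h r))) * indicator {0<..<1} r \<partial>lborel)
      = ennreal ((R + 1 / k) * exp (- k * R) / k)"
    unfolding h_def using assms(1,2)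
    by (subst nn_integral_height_substitution[OF assms(1) _ _ _ l2, where g = "\<lambda>z. z * exp (- k * z)"])
       (auto intro!: derivative_eq_intros continuous_intros simp: field_simps)
qed

lemma poincare_disk_borel [measurable]: "poincare_disk \<in> sets borel"
proof -
  have "poincare_disk = ball 0 1" by (auto simp: poincare_disk_def)
  then show ?thesis by (metis borel_open open_ball)
qed

lemma space_liouville_disk [simp]: "space (liouville_disk R) = poincare_disk"
  by (simp add: liouville_disk_def liouville_measure_def space_restrict_space)

lemma sets_liouville_disk [measurable_cong]:
  "sets (liouville_disk R) = sets (restrict_space borel poincare_disk)"
  by (simp add: liouville_disk_def liouville_measure_def sets_restrict_space)

lemma nn_integral_liouville_disk:
  assumes R: "R > 0" and [measurable]: "u \<in> borel_measurable borel"
  shows "(\<integral>\<^sup>+ w. u w \<partial>liouville_disk R) =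
    (\<integral>\<^sup>+ w. ennreal (4 * R / (1 - (cmod w)\<^sup>2)\<^sup>2) * u w * indicator poincare_disk w \<partial>lborel)"
proof -
  have "\<bar>omega_disk R w 1 \<i>\<bar> = 4 * R / (1 - (cmod w)\<^sup>2)\<^sup>2" for w
    using R by (simp add: omega_disk_def)
  then have "(\<integral>\<^sup>+ w. u w \<partial>liouville_disk R) =
      (\<integral>\<^sup>+ w. ennreal (4 * R / (1 - (cmod w)\<^sup>2)\<^sup>2) * u w \<partial>restrict_space lborel poincare_disk)"
    unfolding liouville_disk_def liouville_measure_def
    by (subst nn_integral_density) (auto intro!: measurable_restrict_space1)
  also have "\<dots> = (\<integral>\<^sup>+ w. ennreal (4 * R / (1 - (cmod w)\<^sup>2)\<^sup>2) * u w * indicator poincare_disk w \<partial>lborel)"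
    by (subst nn_integral_restrict_space) auto
  finally show ?thesis .
qed

lemma nn_integral_liouville_disk_polar:
  assumes R: "R > 0" and [measurable]: "u \<in> borel_measurable borel"
  shows "(\<integral>\<^sup>+ w. u w \<partial>liouville_disk R) =
    (\<integral>\<^sup>+ \<phi>. (\<integral>\<^sup>+ r. ennreal (4 * R * r / (1 - r\<^sup>2)\<^sup>2) * u (rcis r \<phi>) * indicator {0<..<1} r \<partial>lborel)
        * indicator {0..<2 * pi} \<phi> \<partial>lborel)"
proof -
  have eq: "ennreal r * (ennreal (4 * R / (1 - r\<^sup>2)\<^sup>2) * v * indicator poincare_disk (rcis r \<phi>))
      = ennreal (4 * R * r / (1 - r\<^sup>2)\<^sup>2) * v * indicator {0<..<1} r" for r \<phi> :: real and v :: ennreal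
  proof (cases "r \<in> {0<..<1}")
    case True
    then have "ennreal r * ennreal (4 * R / (1 - r\<^sup>2)\<^sup>2) = ennreal (4 * R * r / (1 - r\<^sup>2)\<^sup>2)"
      using R by (subst ennreal_mult[symmetric]) (auto simp: mult_ac)
    with True show ?thesis
      by (simp add: poincare_disk_def indicator_def mult.assoc[symmetric])
  next
    case False
    then show ?thesis by (cases "r \<le> 0") (auto simp: poincare_disk_def indicator_def ennreal_neg)
  qed
  show ?thesis
    unfolding nn_integral_liouville_disk[OF R assms(2)]
    by (subst nn_integral_polar) (simp_all add: eq)
qed

lemma nn_integral_liouville_disk_radial:
  assumes R: "R > 0" and [measurable]: "u \<in> borel_measurable borel"
  shows "(\<integral>\<^sup>+ w. u (cmod w) \<partial>liouville_disk R) =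
    ennreal (2 * pi) * (\<integral>\<^sup>+ r. ennreal (4 * R * r / (1 - r\<^sup>2)\<^sup>2) * u r * indicator {0<..<1} r \<partial>lborel)"
proof -
  have "(\<integral>\<^sup>+ r. ennreal (4 * R * r / (1 - r\<^sup>2)\<^sup>2) * u \<bar>r\<bar> * indicator {0<..<1} r \<partial>lborel)
      = (\<integral>\<^sup>+ r. ennreal (4 * R * r / (1 - r\<^sup>2)\<^sup>2) * u r * indicator {0<..<1} r \<partial>lborel)"
    by (intro nn_integral_cong) (auto split: split_indicator)
  then show ?thesis
    by (subst nn_integral_liouville_disk_polar[OF R])
       (simp_all add: nn_integral_cmult_indicator mult.commute[of "ennreal (2 * pi)"])
qed

lemma liouville_disk_eq_density_polar:
  assumes R: "R > 0"
  shows "liouville_disk R = density polar_measure (\<lambda>w. ennreal (4 * R * cmod w / (1 - (cmod w)\<^sup>2)\<^sup>2))"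
proof (rule measure_eqI)
  show "sets (liouville_disk R) = sets (density polar_measure (\<lambda>w. ennreal (4 * R * cmod w / (1 - (cmod w)\<^sup>2)\<^sup>2)))"
    by (simp add: sets_liouville_disk polar_measure_def)
  fix A assume "A \<in> sets (liouville_disk R)"
  then have AD: "A \<in> sets (restrict_space borel poincare_disk)" by (simp add: sets_liouville_disk)
  then have [measurable]: "A \<in> sets borel"
    by (simp add: sets_restrict_space_iff)
  let ?Q = "{0<..<1} \<times> {0..<2 * pi} :: (real \<times> real) set"
  let ?d = "\<lambda>w. ennreal (4 * R * cmod w / (1 - (cmod w)\<^sup>2)\<^sup>2)"
  have [measurable]: "?Q \<in> sets (borel \<Otimes>\<^sub>M borel)" by simp
  have [measurable]: "(\<lambda>(r, \<phi>). rcis r \<phi>) \<in> measurable (restrict_space (lborel \<Otimes>\<^sub>M lborel) ?Q)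
      (restrict_space borel poincare_disk)"
    by (rule measurable_restrict_space3) (auto simp: poincare_disk_def)
  have "emeasure (liouville_disk R) A = (\<integral>\<^sup>+ w. indicator A w \<partial>liouville_disk R)"
    using \<open>A \<in> sets (liouville_disk R)\<close> by simp
  also have "\<dots> = (\<integral>\<^sup>+ \<phi>. (\<integral>\<^sup>+ r. ennreal (4 * R * r / (1 - r\<^sup>2)\<^sup>2) * indicator A (rcis r \<phi>) * indicator {0<..<1} r \<partial>lborel)
        * indicator {0..<2 * pi} \<phi> \<partial>lborel)"
    by (rule nn_integral_liouville_disk_polar[OF R]) simp
  also have "\<dots> = (\<integral>\<^sup>+ \<phi>. (\<integral>\<^sup>+ r. ?d (rcis r \<phi>) * indicator A (rcis r \<phi>) * indicator ?Q (r, \<phi>) \<partial>lborel) \<partial>lborel)"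
    by (subst nn_integral_multc[symmetric])
       (auto intro!: nn_integral_cong split: split_indicator)
  also have "\<dots> = (\<integral>\<^sup>+ p. (case p of (r, \<phi>) \<Rightarrow> ?d (rcis r \<phi>) * indicator A (rcis r \<phi>)) * indicator ?Q p \<partial>(lborel \<Otimes>\<^sub>M lborel))"
    by (subst lborel_pair.nn_integral_snd[symmetric]) (auto simp: mult.assoc)
  also have "\<dots> = (\<integral>\<^sup>+ p. (case p of (r, \<phi>) \<Rightarrow> ?d (rcis r \<phi>) * indicator A (rcis r \<phi>)) \<partial>(restrict_space (lborel \<Otimes>\<^sub>M lborel) ?Q))"
    by (subst nn_integral_restrict_space) (auto)
  also have "\<dots> = (\<integral>\<^sup>+ w. ?d w * indicator A w \<partial>polar_measure)"
    unfolding polar_measure_def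
    by (subst nn_integral_distr)
       (auto intro!: measurable_restrict_space1 nn_integral_cong simp: split_beta)
  also have "\<dots> = emeasure (density polar_measure ?d) A"
    using AD by (subst emeasure_density) (auto simp: polar_measure_def intro!: measurable_restrict_space1)
  finally show "emeasure (liouville_disk R) A = emeasure (density polar_measure ?d) A" .
qed

text \<open>The coordinate of \<open>J w\<close> along \<open>e\<^sub>3\<close>, by the formula for the inverse of \<open>psi\<close>.\<close>

definition disk_height :: "real \<Rightarrow> complex \<Rightarrow> real" where
  "disk_height R w = R * (1 + (cmod w)\<^sup>2) / (1 - (cmod w)\<^sup>2)"

lemma measurable_disk_height [measurable]: "disk_height R \<in> borel_measurable borel"
  unfolding disk_height_def by measurable

lemma measurable_liouville_disk:
  "f \<in> borel_measurable borel \<Longrightarrow> f \<in> borel_measurable (liouville_disk R)"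
  by (subst measurable_cong_sets[OF sets_liouville_disk refl]) (rule measurable_restrict_space1)

lemma disk_height_nonneg: "R > 0 \<Longrightarrow> w \<in> poincare_disk \<Longrightarrow> disk_height R w \<ge> 0"
  by (auto simp: disk_height_def poincare_disk_def abs_square_less_1 intro!: divide_nonneg_pos)

lemma has_bochner_integral_height_exp:
  assumes R: "R > 0" and k: "k > 0"
  shows "has_bochner_integral (liouville_disk R) (\<lambda>w. exp (- k * disk_height R w))
      (2 * pi * exp (- k * R) / k)"
    and "has_bochner_integral (liouville_disk R) (\<lambda>w. disk_height R w * exp (- k * disk_height R w))
      (2 * pi * (R + 1 / k) * exp (- k * R) / k)"
proof -
  let ?h = "\<lambda>r. R * (1 + r\<^sup>2) / (1 - r\<^sup>2)"
  have *: "ennreal (4 * R * r / (1 - r\<^sup>2)\<^sup>2) * ennreal b * indicator {0<..<1} r =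
      ennreal (4 * R * r / (1 - r\<^sup>2)\<^sup>2 * b) * indicator {0<..<1} r" for r b
    using R by (cases "r \<in> {0<..<1}") (auto simp del: times_divide_eq_left simp: ennreal_mult')
  have "(\<integral>\<^sup>+ w. ennreal (exp (- k * disk_height R w)) \<partial>liouville_disk R)
      = ennreal (2 * pi) * ennreal (exp (- k * R) / k)"
    unfolding disk_height_def
    by (subst nn_integral_liouville_disk_radial[OF R, where u = "\<lambda>r. ennreal (exp (- k * ?h r))"])
       (simp_all only: * nn_integral_height_exp[OF R k], measurable)
  also have "\<dots> = ennreal (2 * pi * exp (- k * R) / k)"
    using k by (subst ennreal_mult[symmetric]) auto
  finally show "has_bochner_integral (liouville_disk R) (\<lambda>w. exp (- k * disk_height R w))
      (2 * pi * exp (- k * R) / k)"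
    using k by (intro has_bochner_integral_nn_integral) (auto intro!: measurable_liouville_disk)
  have "(\<integral>\<^sup>+ w. ennreal (disk_height R w * exp (- k * disk_height R w)) \<partial>liouville_disk R)
      = ennreal (2 * pi) * ennreal ((R + 1 / k) * exp (- k * R) / k)"
    unfolding disk_height_def
    by (subst nn_integral_liouville_disk_radial[OF R, where u = "\<lambda>r. ennreal (?h r * exp (- k * ?h r))"])
       (simp_all only: * nn_integral_height_exp[OF R k], measurable)
  also have "\<dots> = ennreal (2 * pi * (R + 1 / k) * exp (- k * R) / k)"
    using k R by (subst ennreal_mult[symmetric]) (auto simp: mult_ac)
  finally show "has_bochner_integral (liouville_disk R) (\<lambda>w. disk_height R w * exp (- k * disk_height R w))
      (2 * pi * (R + 1 / k) * exp (- k * R) / k)"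
    using k R by (intro has_bochner_integral_nn_integral)
      (auto intro!: measurable_liouville_disk AE_I2 simp: disk_height_nonneg)
qed

section \<open>Past time-like vectors as the generalized temperatures\<close>

text \<open>In coordinates \<open>\<beta> = x e\<^sub>1 + y e\<^sub>2 + z e\<^sub>3\<close> this is \<open>- z - sqrt (x\<^sup>2 + y\<^sup>2)\<close>: the Lorentz product with
  \<open>e\<^sub>3\<close> is minus the third coordinate. It measures how far \<open>\<beta>\<close> lies inside the past cone.\<close>

definition past_margin :: "('f::euclidean_space \<Rightarrow> 'f \<Rightarrow> real) \<Rightarrow> 'f ^ 3 \<Rightarrow> 'f \<Rightarrow> real" where
  "past_margin sp e \<beta> = sp \<beta> (e $ 3) - sqrt ((sp \<beta> (e $ 1))\<^sup>2 + (sp \<beta> (e $ 2))\<^sup>2)"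

lemma admissible_basisD:
  fixes sp :: "'f::euclidean_space \<Rightarrow> 'f \<Rightarrow> real"
  assumes "minkowski_space sp Or Fut" "admissible_basis sp Or Fut e"
  shows "DIM('f) = 3" "lorentz_product sp" "orthonormal_frame sp e"
  using assms by (auto simp: minkowski_space_def admissible_basis_def)

lemma continuous_past_margin:
  assumes "lorentz_product sp"
  shows "continuous_on UNIV (past_margin sp e)"
proof -
  have "continuous_on UNIV (\<lambda>\<beta>. sp \<beta> v)" for v
    using assms by (intro linear_continuous_on)
      (auto simp: lorentz_product_def bilinear_def linear_conv_bounded_linear)
  then show ?thesis
    unfolding past_margin_def by (intro continuous_intros)
qed

lemma square_in_frame:
  fixes sp :: "'f::euclidean_space \<Rightarrow> 'f \<Rightarrow> real"
  assumes "DIM('f) = 3" "lorentz_product sp" "orthonormal_frame sp e"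
  shows "sp v v = (sp v (e $ 1))\<^sup>2 + (sp v (e $ 2))\<^sup>2 - (sp v (e $ 3))\<^sup>2"
proof -
  define x y z where "x = sp v (e $ 1)" and "y = sp v (e $ 2)" and "z = - sp v (e $ 3)"
  have "v = x *\<^sub>R e $ 1 + y *\<^sub>R e $ 2 + z *\<^sub>R e $ 3"
    using frame_expansion[OF assms, of v] by (simp add: x_def y_def z_def)
  then have "sp v v = x * x + y * y - z * z"
    using frame_product[OF assms(2,3), of x y z x y z] by simp
  then show ?thesis by (simp add: x_def y_def z_def power2_eq_square)
qed

text \<open>One component of the causal cone lies on each side of \<open>sp v (e $ 3) = 0\<close>. That \<open>Fut\<close> fills its side
  holds because the segment from \<open>e $ 3\<close> to a causal vector on the same side stays in the cone.\<close>

lemma future_iff: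
  assumes F: "minkowski_space sp Or Fut" and e: "admissible_basis sp Or Fut e"
  shows "v \<in> Fut \<longleftrightarrow> v \<in> causal_cone sp \<and> sp v (e $ 3) < 0"
proof
  have C: "Fut \<in> components (causal_cone sp)" and e3: "e $ 3 \<in> Fut"
    using F e by (auto simp: minkowski_space_def admissible_basis_def)
  note F' = admissible_basisD[OF F e]
  have bl: "bilinear sp" using F'(2) by (simp add: lorentz_product_def)
  show "v \<in> causal_cone sp \<and> sp v (e $ 3) < 0" if "v \<in> Fut"
    using in_components_subset[OF C] future_product_neg[OF F e that] that by auto
  assume v: "v \<in> causal_cone sp \<and> sp v (e $ 3) < 0"
  have vv: "(sp v (e $ 1))\<^sup>2 + (sp v (e $ 2))\<^sup>2 \<le> (sp v (e $ 3))\<^sup>2"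
    using v square_in_frame[OF F', of v] by (simp add: causal_cone_def)
  have o: "sp (e $ 3) (e $ 1) = 0" "sp (e $ 3) (e $ 2) = 0" "sp (e $ 3) (e $ 3) = - 1"
    using F'(3) by (auto simp: orthonormal_frame_def)
  have "closed_segment (e $ 3) v \<subseteq> causal_cone sp"
  proof
    fix u assume "u \<in> closed_segment (e $ 3) v"
    then obtain t where t: "0 \<le> t" "t \<le> 1" and u: "u = (1 - t) *\<^sub>R e $ 3 + t *\<^sub>R v"
      by (auto simp: in_segment)
    have u1: "sp u (e $ 1) = t * sp v (e $ 1)" "sp u (e $ 2) = t * sp v (e $ 2)"
      "sp u (e $ 3) = - ((1 - t) + t * - sp v (e $ 3))"
      unfolding u by (simp_all add: bilinear_ladd[OF bl] bilinear_lmul[OF bl] o)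
    have pos: "(1 - t) + t * - sp v (e $ 3) > 0"
      using t v mult_pos_neg[of t "sp v (e $ 3)"] by (cases "t = 0") auto
    have "(t * sp v (e $ 1))\<^sup>2 + (t * sp v (e $ 2))\<^sup>2 \<le> (t * - sp v (e $ 3))\<^sup>2"
      using mult_left_mono[OF vv, of "t\<^sup>2"] by (simp add: power_mult_distrib algebra_simps)
    also have "\<dots> \<le> ((1 - t) + t * - sp v (e $ 3))\<^sup>2"
      using t v by (intro power_mono) (auto simp: mult_nonneg_nonpos)
    finally have "sp u u \<le> 0"
      unfolding square_in_frame[OF F', of u] u1 power2_minus by simp
    moreover have "u \<noteq> 0"
      using u1(3) pos bilinear_lzero[OF bl] by auto
    ultimately show "u \<in> causal_cone sp" by (simp add: causal_cone_def)
  qed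
  then have "closed_segment (e $ 3) v \<subseteq> Fut"
    using e3 by (intro components_maximal[OF C]) auto
  then show "v \<in> Fut" by auto
qed

lemma timelike_past_iff:
  assumes F: "minkowski_space sp Or Fut" and e: "admissible_basis sp Or Fut e"
  shows "time_like sp \<beta> \<and> \<beta> \<in> past sp Fut \<longleftrightarrow> past_margin sp e \<beta> > 0"
proof -
  note F' = admissible_basisD[OF F e]
  have bl: "bilinear sp" using F'(2) by (simp add: lorentz_product_def)
  define a b c where "a = sp \<beta> (e $ 1)" and "b = sp \<beta> (e $ 2)" and "c = sp \<beta> (e $ 3)"
  have s: "sp \<beta> \<beta> = a\<^sup>2 + b\<^sup>2 - c\<^sup>2" by (simp add: square_in_frame[OF F'] a_def b_def c_def)
  have "time_like sp \<beta> \<and> \<beta> \<in> past sp Fut \<longleftrightarrow> a\<^sup>2 + b\<^sup>2 < c\<^sup>2 \<and> 0 \<le> c"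
    using s bilinear_lzero[OF bl]
    by (auto simp: time_like_def past_def future_iff[OF F e] causal_cone_def c_def)
  also have "\<dots> \<longleftrightarrow> sqrt (a\<^sup>2 + b\<^sup>2) < c"
    by (smt (verit) real_less_lsqrt real_sqrt_ge_zero sum_power2_ge_zero real_sqrt_less_iff real_sqrt_abs real_sqrt_less_mono real_sqrt_unique)
  finally show ?thesis by (simp add: past_margin_def a_def b_def c_def)
qed

lemma pairing_J_disk:
  assumes "lorentz_product sp" "orthonormal_frame sp e" "R > 0" "w \<in> poincare_disk"
  shows "sp (J_disk sp e R w) \<beta> = R / (1 - (cmod w)\<^sup>2) *
    (2 * (sp \<beta> (e $ 1) * Re w + sp \<beta> (e $ 2) * Im w) + sp \<beta> (e $ 3) * (1 + (cmod w)\<^sup>2))"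
proof -
  have bl: "bilinear sp" and sym: "sp u v = sp v u" for u v
    using assms(1) by (auto simp: lorentz_product_def)
  show ?thesis
    unfolding J_disk_eq(1)[OF assms]
    by (simp add: bilinear_ladd[OF bl] bilinear_lmul[OF bl] bilinear_radd[OF bl] bilinear_rmul[OF bl]
        sym[of _ \<beta>] algebra_simps)
qed

text \<open>Cauchy-Schwarz in the plane of \<open>e\<^sub>1\<close> and \<open>e\<^sub>2\<close>, together with \<open>2 |w| \<le> 1 + |w|\<^sup>2\<close>, i.e. the horizontal part
  of \<open>J w\<close> is no longer than its height.\<close>

lemma pairing_J_disk_ge:
  assumes "lorentz_product sp" "orthonormal_frame sp e" "R > 0" "w \<in> poincare_disk"
  shows "past_margin sp e \<beta> * disk_height R w \<le> sp (J_disk sp e R w) \<beta>"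
proof -
  define a b c where "a = sp \<beta> (e $ 1)" and "b = sp \<beta> (e $ 2)" and "c = sp \<beta> (e $ 3)"
  define n where "n = (cmod w)\<^sup>2"
  have n: "n < 1" using assms(4) by (simp add: n_def poincare_disk_def abs_square_less_1)
  have "\<bar>a * Re w + b * Im w\<bar> \<le> sqrt (a\<^sup>2 + b\<^sup>2) * cmod w"
    using Cauchy_Schwarz_ineq2[of "Complex a b" w] by (simp add: inner_complex_def cmod_def)
  moreover have "2 * cmod w \<le> 1 + n"
    using sum_squares_bound[of 1 "cmod w"] by (simp add: n_def)
  then have "sqrt (a\<^sup>2 + b\<^sup>2) * (2 * cmod w) \<le> sqrt (a\<^sup>2 + b\<^sup>2) * (1 + n)"
    by (rule mult_left_mono) simp
  ultimately have "(c - sqrt (a\<^sup>2 + b\<^sup>2)) * (1 + n) \<le> 2 * (a * Re w + b * Im w) + c * (1 + n)"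
    by (simp add: left_diff_distrib)
  then have "R / (1 - n) * ((c - sqrt (a\<^sup>2 + b\<^sup>2)) * (1 + n))
      \<le> R / (1 - n) * (2 * (a * Re w + b * Im w) + c * (1 + n))"
    using n assms(3) by (intro mult_left_mono) auto
  then show ?thesis
    unfolding pairing_J_disk[OF assms] past_margin_def disk_height_def
    by (simp add: a_def b_def c_def n_def mult_ac)
qed

text \<open>The pairing is \<open>R q w / (1 - |w|\<^sup>2)\<close> with \<open>q\<close> continuous on the closed disk, and a negative margin makes
  \<open>q\<close> negative at the boundary point \<open>u\<close> opposite to the horizontal part of \<open>\<beta>\<close> (at any boundary
  point if that part vanishes). On a disk of radius \<open>t\<close> tangent to
  the unit circle at \<open>u\<close> one has \<open>1 - |w|\<^sup>2 \<le> 4 t\<close>: the Liouville measure of that disk is bounded below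
  independently of \<open>t\<close>, whereas the integrand is at least of order \<open>1 / t\<close>.\<close>

lemma nn_integral_J_disk_lower_bound:
  assumes "lorentz_product sp" "orthonormal_frame sp e" and R: "R > 0"
    and neg: "past_margin sp e \<beta> < 0"
    and f: "\<And>w. w \<in> poincare_disk \<Longrightarrow> exp (- sp (J_disk sp e R w) \<beta>) \<le> f w"
  obtains K t0 :: real where "K > 0" "t0 > 0"
    "\<And>t. 0 < t \<Longrightarrow> t \<le> t0 \<Longrightarrow> ennreal (K / t) \<le> (\<integral>\<^sup>+ w. ennreal (f w) \<partial>liouville_disk R)"
proof -
  define a b c where "a = sp \<beta> (e $ 1)" and "b = sp \<beta> (e $ 2)" and "c = sp \<beta> (e $ 3)"
  define s where "s = sqrt (a\<^sup>2 + b\<^sup>2)"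
  define q where "q w = 2 * (a * Re w + b * Im w) + c * (1 + (cmod w)\<^sup>2)" for w
  define \<delta> where "\<delta> = s - c"
  have \<delta>: "\<delta> > 0" using neg by (simp add: \<delta>_def s_def past_margin_def a_def b_def c_def)
  obtain u where u: "cmod u = 1" "a * Re u + b * Im u = - s"
  proof (cases "s = 0")
    case True
    then have "a = 0" "b = 0" by (auto simp: s_def sum_power2_eq_zero_iff)
    with True show ?thesis by (intro that[of 1]) auto
  next
    case False
    have sc: "s = cmod (Complex a b)" by (simp add: s_def cmod_def)
    have s2: "a * a + b * b = s * s" by (simp add: s_def flip: power2_eq_square)
    have "cmod (- Complex a b / of_real s) = 1" using False sc by (simp add: norm_divide)
    moreover have "a * Re (- Complex a b / of_real s) + b * Im (- Complex a b / of_real s) = - s"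
      using False s2 by (simp add: divide_simps)
    ultimately show ?thesis by (rule that)
  qed
  have "isCont q u" unfolding q_def
    by (intro continuous_intros linear_continuous_at bounded_linear_Re bounded_linear_Im)
  moreover have qu: "q u = - 2 * \<delta>" using u by (simp add: q_def \<delta>_def)
  ultimately obtain \<eta> where \<eta>: "\<eta> > 0" "\<And>w. dist w u < \<eta> \<Longrightarrow> dist (q w) (q u) < \<delta>"
    using \<delta> unfolding continuous_at_eps_delta by blast
  show thesis
  proof (rule that[of "pi * R\<^sup>2 * \<delta> / 16" "min (\<eta> / 2) (1 / 2)"])
    fix t :: real assume t: "0 < t" "t \<le> min (\<eta> / 2) (1 / 2)"
    define B where "B = ball ((1 - t) *\<^sub>R u) t"
    have B: "w \<in> poincare_disk" "1 - (cmod w)\<^sup>2 \<le> 4 * t" "0 < 1 - (cmod w)\<^sup>2"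
        "R * \<delta> / (4 * t) \<le> - sp (J_disk sp e R w) \<beta>" if "w \<in> B" for w
    proof -
      have d: "cmod (w - (1 - t) *\<^sub>R u) < t"
        using that by (simp add: B_def dist_norm norm_minus_commute)
      have n1: "cmod ((1 - t) *\<^sub>R u) = 1 - t" using t u by simp
      have lt: "cmod w < 1"
        using norm_triangle_ineq[of "w - (1 - t) *\<^sub>R u" "(1 - t) *\<^sub>R u"] d n1 by simp
      then show wd: "w \<in> poincare_disk" by (simp add: poincare_disk_def)
      have gt: "1 - 2 * t < cmod w"
        using norm_triangle_ineq2[of "(1 - t) *\<^sub>R u" w] d n1 by (simp add: norm_minus_commute)
      have "1 - (cmod w)\<^sup>2 = (1 - cmod w) * (1 + cmod w)" by (simp add: power2_eq_square algebra_simps)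
      also have "\<dots> \<le> (2 * t) * 2" using gt lt t by (intro mult_mono) auto
      finally show n: "1 - (cmod w)\<^sup>2 \<le> 4 * t" by simp
      show p: "0 < 1 - (cmod w)\<^sup>2" using lt by (simp add: abs_square_less_1)
      have "w - u = (w - (1 - t) *\<^sub>R u) - t *\<^sub>R u" by (simp add: algebra_simps)
      then have "cmod (w - u) \<le> cmod (w - (1 - t) *\<^sub>R u) + cmod (t *\<^sub>R u)"
        using norm_triangle_ineq4 by metis
      then have "dist w u < \<eta>" using d t u by (simp add: dist_norm)
      then have "dist (q w) (q u) < \<delta>" by (rule \<eta>)
      then have "\<delta> \<le> - q w" using qu by (simp add: dist_real_def)
      moreover have "R / (4 * t) \<le> R / (1 - (cmod w)\<^sup>2)"
        using R n p by (intro divide_left_mono) auto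
      ultimately have "R / (4 * t) * \<delta> \<le> R / (1 - (cmod w)\<^sup>2) * - q w"
        using R t \<delta> p by (intro mult_mono) auto
      also have "\<dots> = - (R / (1 - (cmod w)\<^sup>2) * q w)" by simp
      finally show "R * \<delta> / (4 * t) \<le> - sp (J_disk sp e R w) \<beta>"
        unfolding pairing_J_disk[OF assms(1-3) wd] by (simp add: q_def a_def b_def c_def)
    qed
    have [measurable]: "B \<in> sets borel" by (simp add: B_def)
    let ?m = "R * \<delta> / (4 * t)"
    have "ennreal (pi * R\<^sup>2 * \<delta> / 16 / t) = ennreal (R / (4 * t\<^sup>2) * ?m) * emeasure lborel B"
      unfolding B_def using t R \<delta>
      by (simp add: emeasure_ball unit_ball_vol_2 flip: ennreal_mult)
         (simp add: field_simps power2_eq_square)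
    also have "\<dots> = (\<integral>\<^sup>+ w. ennreal (R / (4 * t\<^sup>2) * ?m) * indicator B w \<partial>lborel)"
      by (simp add: nn_integral_cmult_indicator)
    also have "\<dots> \<le> (\<integral>\<^sup>+ w. ennreal (4 * R / (1 - (cmod w)\<^sup>2)\<^sup>2) * (ennreal ?m * indicator B w)
        * indicator poincare_disk w \<partial>lborel)"
    proof (rule nn_integral_mono)
      fix w
      show "ennreal (R / (4 * t\<^sup>2) * ?m) * indicator B w \<le>
        ennreal (4 * R / (1 - (cmod w)\<^sup>2)\<^sup>2) * (ennreal ?m * indicator B w) * indicator poincare_disk w"
      proof (cases "w \<in> B")
        case True
        have "(1 - (cmod w)\<^sup>2)\<^sup>2 \<le> (4 * t)\<^sup>2" using B[OF True] by (intro power_mono) auto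
        then have "4 * R / (4 * t)\<^sup>2 \<le> 4 * R / (1 - (cmod w)\<^sup>2)\<^sup>2"
          using B(3)[OF True] R t by (intro divide_left_mono) auto
        then have "R / (4 * t\<^sup>2) \<le> 4 * R / (1 - (cmod w)\<^sup>2)\<^sup>2" by (simp add: power_mult_distrib)
        then have "R / (4 * t\<^sup>2) * ?m \<le> 4 * R / (1 - (cmod w)\<^sup>2)\<^sup>2 * ?m"
          using R t \<delta> by (intro mult_right_mono) auto
        then have "ennreal (R / (4 * t\<^sup>2) * ?m) \<le> ennreal (4 * R / (1 - (cmod w)\<^sup>2)\<^sup>2) * ennreal ?m"
          using R t \<delta> by (subst ennreal_mult[symmetric]) (auto intro!: ennreal_leI)
        then show ?thesis using True B(1)[OF True] by simp
      qed simp
    qed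
    also have "\<dots> = (\<integral>\<^sup>+ w. ennreal ?m * indicator B w \<partial>liouville_disk R)"
      by (rule nn_integral_liouville_disk[OF R, symmetric]) measurable
    also have "\<dots> \<le> (\<integral>\<^sup>+ w. ennreal (f w) \<partial>liouville_disk R)"
    proof (rule nn_integral_mono)
      fix w assume "w \<in> space (liouville_disk R)"
      then have w: "w \<in> poincare_disk" by simp
      show "ennreal ?m * indicator B w \<le> ennreal (f w)"
      proof (cases "w \<in> B")
        case True
        have "?m \<le> exp (- sp (J_disk sp e R w) \<beta>)"
          using B(4)[OF True] exp_ge_add_one_self[of "- sp (J_disk sp e R w) \<beta>"] by linarith
        then show ?thesis using f[OF w] True by (simp add: ennreal_leI)
      qed simp
    qed
    finally show "ennreal (pi * R\<^sup>2 * \<delta> / 16 / t) \<le> (\<integral>\<^sup>+ w. ennreal (f w) \<partial>liouville_disk R)" .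
  qed (use R \<delta> \<eta> in auto)
qed

lemma past_margin_nonneg_if_integrable:
  assumes "lorentz_product sp" "orthonormal_frame sp e" and R: "R > 0"
    and f: "integrable (liouville_disk R) f"
      "\<And>w. w \<in> poincare_disk \<Longrightarrow> exp (- sp (J_disk sp e R w) \<beta>) \<le> f w"
  shows "past_margin sp e \<beta> \<ge> 0"
proof (rule ccontr)
  assume "\<not> past_margin sp e \<beta> \<ge> 0"
  then have "past_margin sp e \<beta> < 0" by simp
  then obtain K t0 :: real where K: "K > 0" "t0 > 0"
    "\<And>t. 0 < t \<Longrightarrow> t \<le> t0 \<Longrightarrow> ennreal (K / t) \<le> (\<integral>\<^sup>+ w. ennreal (f w) \<partial>liouville_disk R)"
    using nn_integral_J_disk_lower_bound[OF assms(1-3) _ f(2)] by metis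
  have nn: "f w \<ge> 0" if "w \<in> poincare_disk" for w
    using f(2)[OF that] exp_ge_zero order_trans by blast
  define I where "I = (LINT w|liouville_disk R. f w)"
  have I: "(\<integral>\<^sup>+ w. ennreal (f w) \<partial>liouville_disk R) = ennreal I" "I \<ge> 0"
    using f nn unfolding I_def
    by (auto intro!: nn_integral_eq_integral Bochner_Integration.integral_nonneg AE_I2)
  define t where "t = min t0 (K / (2 * (I + 1)))"
  have t: "0 < t" "t \<le> t0" using K I by (auto simp: t_def)
  have "K / t \<le> I" using K(3)[OF t] I by (simp add: ennreal_le_iff)
  then have "K \<le> I * t" using t by (simp add: divide_simps)
  also have "\<dots> \<le> I * (K / (2 * (I + 1)))" using I by (intro mult_left_mono) (auto simp: t_def)
  also have "\<dots> = K * (I / (2 * (I + 1)))" by simp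
  also have "\<dots> < K * 1" using I K by (intro mult_strict_left_mono) auto
  finally show False by simp
qed

lemma generalized_temperatures_disk:
  assumes F: "minkowski_space sp Or Fut" and e: "admissible_basis sp Or Fut e" and R: "R > 0"
  shows "generalized_temperatures sp (liouville_disk R) (J_disk sp e R) = {\<beta>. past_margin sp e \<beta> > 0}"
proof (intro set_eqI iffI CollectI; (drule CollectD)?)
  note F' = admissible_basisD[OF F e]
  fix \<beta> assume m: "past_margin sp e \<beta> > 0"
  define k where "k = past_margin sp e \<beta> / 2"
  have k: "k > 0" using m by (simp add: k_def)
  define U where "U = {\<beta>'. k < past_margin sp e \<beta>'}"
  have "open U" unfolding U_def
    by (intro open_Collect_less continuous_past_margin F' continuous_intros)
  moreover have "\<beta> \<in> U" using m by (simp add: U_def k_def)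
  moreover have "integrable (liouville_disk R) (\<lambda>w. exp (- k * disk_height R w))"
    using has_bochner_integral_height_exp(1)[OF R k] by (rule integrable.intros)
  moreover have "exp (- sp (J_disk sp e R w) \<beta>') \<le> exp (- k * disk_height R w)"
    if "\<beta>' \<in> U" "w \<in> space (liouville_disk R)" for \<beta>' w
  proof -
    have w: "w \<in> poincare_disk" using that by simp
    have "k * disk_height R w \<le> past_margin sp e \<beta>' * disk_height R w"
      using that(1) disk_height_nonneg[OF R w] by (intro mult_right_mono) (auto simp: U_def)
    also have "\<dots> \<le> sp (J_disk sp e R w) \<beta>'" by (rule pairing_J_disk_ge[OF F'(2,3) R w])
    finally show ?thesis by simp
  qed
  ultimately show "\<beta> \<in> generalized_temperatures sp (liouville_disk R) (J_disk sp e R)"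
    unfolding generalized_temperatures_def mem_Collect_eq
    by (intro exI[of _ U] exI[of _ "\<lambda>w. exp (- k * disk_height R w)"]) auto
next
  note F' = admissible_basisD[OF F e]
  have bl: "bilinear sp" using F'(2) by (simp add: lorentz_product_def)
  fix \<beta> assume "\<beta> \<in> generalized_temperatures sp (liouville_disk R) (J_disk sp e R)"
  then obtain U f where U: "open U" "\<beta> \<in> U" and f: "integrable (liouville_disk R) f"
    "\<And>\<beta>' w. \<beta>' \<in> U \<Longrightarrow> w \<in> poincare_disk \<Longrightarrow> exp (- sp (J_disk sp e R w) \<beta>') \<le> f w"
    unfolding generalized_temperatures_def by auto
  have o: "sp (e $ 3) (e $ 1) = 0" "sp (e $ 3) (e $ 2) = 0" "sp (e $ 3) (e $ 3) = - 1"
    using F'(3) by (auto simp: orthonormal_frame_def)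
  (* moving beta slightly towards the future lowers the margin, which excludes margin 0 as well *)
  have "((\<lambda>\<epsilon>. \<beta> + \<epsilon> *\<^sub>R e $ 3) \<longlongrightarrow> \<beta> + 0 *\<^sub>R e $ 3) (at_right 0)"
    by (intro tendsto_intros)
  then have "eventually (\<lambda>\<epsilon>. \<beta> + \<epsilon> *\<^sub>R e $ 3 \<in> U) (at_right 0)"
    using U by (intro topological_tendstoD) auto
  moreover have "eventually (\<lambda>\<epsilon>::real. \<epsilon> > 0) (at_right 0)"
    by (rule eventually_at_right_less)
  ultimately have "eventually (\<lambda>\<epsilon>. \<beta> + \<epsilon> *\<^sub>R e $ 3 \<in> U \<and> \<epsilon> > 0) (at_right 0)"
    by (rule eventually_conj)
  then obtain \<epsilon> :: real where \<epsilon>: "\<epsilon> > 0" "\<beta> + \<epsilon> *\<^sub>R e $ 3 \<in> U"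
    using eventually_happens'[OF trivial_limit_at_right_real] by blast
  have "past_margin sp e (\<beta> + \<epsilon> *\<^sub>R e $ 3) = past_margin sp e \<beta> - \<epsilon>"
    by (simp add: past_margin_def bilinear_ladd[OF bl] bilinear_lmul[OF bl] o)
  moreover have "past_margin sp e (\<beta> + \<epsilon> *\<^sub>R e $ 3) \<ge> 0"
    using f(1) f(2)[OF \<epsilon>(2)] by (rule past_margin_nonneg_if_integrable[OF F'(2,3) R])
  ultimately show "past_margin sp e \<beta> > 0" using \<epsilon> by simp
qed

section \<open>An admissible basis along a past time-like vector\<close>

lemma is_basis_if_orthogonal:
  fixes sp :: "'f::euclidean_space \<Rightarrow> 'f \<Rightarrow> real" and v :: "'f ^ 3"
  assumes dim: "DIM('f) = 3" and bl: "bilinear sp"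
    and orth: "\<And>i j. i \<noteq> j \<Longrightarrow> sp (v $ i) (v $ j) = 0" and nz: "\<And>i. sp (v $ i) (v $ i) \<noteq> 0"
  shows "is_basis v"
proof -
  have inj: "inj (($) v)" by (rule injI) (metis orth nz)
  have ind: "independent (range (($) v))"
  proof
    assume "dependent (range (($) v))"
    then obtain c i where c: "c (v $ i) \<noteq> 0" "(\<Sum>u\<in>range (($) v). c u *\<^sub>R u) = 0"
      by (subst (asm) real_vector.dependent_finite) auto
    have "0 = sp (\<Sum>j\<in>UNIV. c (v $ j) *\<^sub>R v $ j) (v $ i)"
      using c(2) by (simp add: sum.reindex[OF inj] bilinear_lzero[OF bl])
    also have "\<dots> = (\<Sum>j\<in>UNIV. c (v $ j) * sp (v $ j) (v $ i))"
      using bl by (simp add: bilinear_def linear_sum[where f = "\<lambda>x. sp x (v $ i)"]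
          linear_cmul[where f = "\<lambda>x. sp x (v $ i)"])
    also have "\<dots> = (\<Sum>j\<in>UNIV. if j = i then c (v $ i) * sp (v $ i) (v $ i) else 0)"
      by (intro sum.cong) (auto simp: orth)
    finally show False using c(1) nz by simp
  qed
  moreover have "card (range (($) v)) = 3"
    using card_image[OF inj] by simp
  ultimately have "UNIV \<subseteq> span (range (($) v))"
    by (intro card_ge_dim_independent) (auto simp: dim)
  then show ?thesis using inj ind by (auto simp: is_basis_def)
qed

lemma same_orientation_trans:
  assumes "(a, b) \<in> same_orientation" "(b, c) \<in> same_orientation"
  shows "(a, c) \<in> same_orientation"
proof -
  obtain A B :: "real ^ 3 ^ 3" where A: "0 < det A" "\<And>i. b $ i = (\<Sum>j\<in>UNIV. A $ i $ j *\<^sub>R a $ j)"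
    and B: "0 < det B" "\<And>i. c $ i = (\<Sum>j\<in>UNIV. B $ i $ j *\<^sub>R b $ j)"
    using assms unfolding same_orientation_def by auto
  have "c $ i = (\<Sum>j\<in>UNIV. (B ** A) $ i $ j *\<^sub>R a $ j)" for i
  proof -
    have "c $ i = (\<Sum>k\<in>UNIV. \<Sum>j\<in>UNIV. (B $ i $ k * A $ k $ j) *\<^sub>R a $ j)"
      by (simp add: A(2) B(2) scaleR_sum_right)
    also have "\<dots> = (\<Sum>j\<in>UNIV. \<Sum>k\<in>UNIV. (B $ i $ k * A $ k $ j) *\<^sub>R a $ j)"
      by (rule sum.swap)
    finally show ?thesis by (simp add: matrix_matrix_mult_def scaleR_sum_left)
  qed
  moreover have "0 < det (B ** A)" using A(1) B(1) by (simp add: det_mul)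
  ultimately show ?thesis using assms unfolding same_orientation_def by blast
qed

lemma orientation_closed:
  assumes "orientation Or" "a \<in> Or" "(a, b) \<in> same_orientation"
  shows "b \<in> Or"
  using assms same_orientation_trans unfolding orientation_def quotient_def by blast

text \<open>The frame is the image of \<open>e\<close> under the boost that sends \<open>e $ 3\<close> to \<open>- \<beta> / \<parallel>\<beta>\<parallel>\<close>, whose coordinates are
  \<open>(x, y, z)\<close>. The matrix of the boost has determinant 1, so that the orientation is kept.\<close>

lemma exists_admissible_basis_along:
  fixes sp :: "'f::euclidean_space \<Rightarrow> 'f \<Rightarrow> real"
  assumes F: "minkowski_space sp Or Fut" and e: "admissible_basis sp Or Fut e"
    and m: "past_margin sp e \<beta> > 0"
  obtains e' b where "admissible_basis sp Or Fut e'" "\<beta> = b *\<^sub>R e' $ 3" "b < 0"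
proof -
  note F' = admissible_basisD[OF F e]
  have bl: "bilinear sp" using F'(2) by (simp add: lorentz_product_def)
  define N where "N = mnorm sp \<beta>"
  have tp: "time_like sp \<beta> \<and> \<beta> \<in> past sp Fut" using timelike_past_iff[OF F e] m by blast
  then have N: "N > 0" "N\<^sup>2 = - sp \<beta> \<beta>" by (auto simp: N_def mnorm_def time_like_def)
  define x y z where "x = - sp \<beta> (e $ 1) / N" and "y = - sp \<beta> (e $ 2) / N" and "z = sp \<beta> (e $ 3) / N"
  have "sp \<beta> (e $ 3) > 0"
    using m by (smt (verit) past_margin_def real_sqrt_ge_zero sum_power2_ge_zero)
  then have z: "z > 0" using N by (simp add: z_def)
  have "x\<^sup>2 + y\<^sup>2 - z\<^sup>2 = sp \<beta> \<beta> / N\<^sup>2"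
    unfolding square_in_frame[OF F', of \<beta>] x_def y_def z_def
    by (simp add: power_divide diff_divide_distrib add_divide_distrib)
  also have "sp \<beta> \<beta> = - (N\<^sup>2)" using N(2) by simp
  also have "- (N\<^sup>2) / N\<^sup>2 = - 1" using N(1) by simp
  finally have z2: "z * z = 1 + x * x + y * y" by (simp add: power2_eq_square)
  (* entries of the boost: k = 1 / (1 + z) replaces the usual (z - 1) / (x^2 + y^2), which fails for x = y = 0 *)
  define k where "k = 1 / (1 + z)"
  have k: "k * (1 + z) = 1" using z by (simp add: k_def)
  define v :: "'f ^ 3" where "v = vector
    [(1 + x * x * k) *\<^sub>R e $ 1 + (x * y * k) *\<^sub>R e $ 2 + x *\<^sub>R e $ 3,
     (x * y * k) *\<^sub>R e $ 1 + (1 + y * y * k) *\<^sub>R e $ 2 + y *\<^sub>R e $ 3,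
     x *\<^sub>R e $ 1 + y *\<^sub>R e $ 2 + z *\<^sub>R e $ 3]"
  have v: "v $ 1 = (1 + x * x * k) *\<^sub>R e $ 1 + (x * y * k) *\<^sub>R e $ 2 + x *\<^sub>R e $ 3"
     "v $ 2 = (x * y * k) *\<^sub>R e $ 1 + (1 + y * y * k) *\<^sub>R e $ 2 + y *\<^sub>R e $ 3"
     "v $ 3 = x *\<^sub>R e $ 1 + y *\<^sub>R e $ 2 + z *\<^sub>R e $ 3"
    by (simp_all add: v_def)
  note fp = frame_product[OF F'(2,3)]
  have on: "sp (v $ 1) (v $ 1) = 1" "sp (v $ 2) (v $ 2) = 1" "sp (v $ 3) (v $ 3) = - 1"
    "sp (v $ 1) (v $ 2) = 0" "sp (v $ 1) (v $ 3) = 0" "sp (v $ 2) (v $ 3) = 0"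
    unfolding v fp using k z2 by algebra+
  have sym: "sp u u' = sp u' u" for u u' using F'(2) by (auto simp: lorentz_product_def)
  have orth: "sp (v $ i) (v $ j) = 0" if "i \<noteq> j" for i j
    using that on(4-6) sym[of "v $ 2" "v $ 1"] sym[of "v $ 3" "v $ 1"] sym[of "v $ 3" "v $ 2"]
    using exhaust_3[of i] exhaust_3[of j] by auto
  have nz: "sp (v $ i) (v $ i) \<noteq> 0" for i using on(1-3) exhaust_3[of i] by auto
  have basis: "is_basis v" using F'(1) bl orth nz by (rule is_basis_if_orthogonal)
  have "(e, v) \<in> same_orientation"
  proof -
    define A :: "real ^ 3 ^ 3" where "A = vector [vector [1 + x * x * k, x * y * k, x],
      vector [x * y * k, 1 + y * y * k, y], vector [x, y, z]]"
    have "det A = 1" unfolding det_3 A_def using k z2 by simp algebra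
    moreover have "\<forall>i. v $ i = (\<Sum>j\<in>UNIV. A $ i $ j *\<^sub>R e $ j)"
      by (simp add: forall_3 sum_3 v A_def)
    ultimately show ?thesis
      using basis F'(3) unfolding same_orientation_def orthonormal_frame_def
      by (auto intro!: exI[of _ A])
  qed
  then have "v \<in> Or"
    using F e orientation_closed[of Or e v] by (auto simp: minkowski_space_def admissible_basis_def)
  moreover have "v $ 3 \<in> Fut"
  proof -
    have "sp (v $ 3) (e $ 3) < 0" unfolding v frame_product1[OF F'(2,3)] using z by simp
    moreover have "v $ 3 \<noteq> 0" using nz[of 3] bilinear_lzero[OF bl] by auto
    ultimately show ?thesis unfolding future_iff[OF F e] causal_cone_def using on(3) by simp
  qed
  ultimately have "admissible_basis sp Or Fut v"
    using basis orth on by (simp add: admissible_basis_def orthonormal_frame_def)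
  moreover have "\<beta> = (- N) *\<^sub>R v $ 3"
    using frame_expansion[OF F', of \<beta>] N
    by (simp add: v x_def y_def z_def scaleR_add_right scaleR_diff_right)
  ultimately show thesis using N by (intro that[of v "- N"]) auto
qed

section \<open>The Gibbs state along the axis of the frame\<close>

text \<open>The Liouville measure is invariant under \<open>w \<mapsto> - w\<close>. If \<open>u\<close> is not integrable, the
  value 0 is the convention for its integral.\<close>

lemma integral_liouville_disk_odd:
  fixes u :: "complex \<Rightarrow> real"
  assumes [measurable]: "u \<in> borel_measurable borel" and odd: "\<And>w. u (- w) = - u w"
  shows "(LINT w|liouville_disk R. u w) = 0"
proof -
  define g where "g w = indicator poincare_disk w *\<^sub>R (\<bar>omega_disk R w 1 \<i>\<bar> * u w)" for w
  have [measurable]: "(\<lambda>w. omega_disk R w 1 \<i>) \<in> borel_measurable borel"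
    unfolding omega_disk_def by measurable
  have [measurable]: "g \<in> borel_measurable borel" unfolding g_def by measurable
  have L: "(LINT w|liouville_disk R. u w) = (LINT w|lborel. g w)"
    unfolding liouville_disk_def liouville_measure_def g_def
    by (subst integral_density)
       (auto simp: integral_restrict_space intro!: measurable_restrict_space1)
  have "g (- w) = - g w" for w
    by (auto simp: g_def odd omega_disk_def poincare_disk_def indicator_def)
  moreover have "(lborel :: complex measure) = distr lborel borel uminus"
    using lborel_affine[of "-1" "0 :: complex"] by (simp add: density_1)
  then have "(LINT w|lborel. g w) = (LINT w|lborel. g (- w))"
    using integral_distr[of uminus lborel borel g] by simp
  ultimately have "(LINT w|lborel. g w) = 0" by simp
  then show ?thesis by (simp add: L)
qed

lemma density_cong_space:
  assumes "\<And>x. x \<in> space M \<Longrightarrow> f x = g x"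
  shows "density M f = density M g"
proof -
  have "(\<integral>\<^sup>+ x. f x * indicator A x \<partial>M) = (\<integral>\<^sup>+ x. g x * indicator A x \<partial>M)" for A
    by (intro nn_integral_cong) (simp add: assms)
  then show ?thesis by (simp add: density_def)
qed

lemma pairing_J_disk_axis:
  assumes "lorentz_product sp" "orthonormal_frame sp e" "R > 0" "w \<in> poincare_disk"
  shows "sp (J_disk sp e R w) (b *\<^sub>R e $ 3) = - b * disk_height R w"
proof -
  have bl: "bilinear sp" using assms(1) by (simp add: lorentz_product_def)
  have "sp (b *\<^sub>R e $ 3) (e $ 1) = 0" "sp (b *\<^sub>R e $ 3) (e $ 2) = 0" "sp (b *\<^sub>R e $ 3) (e $ 3) = - b"
    using assms(2) by (auto simp: orthonormal_frame_def bilinear_lmul[OF bl])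
  then show ?thesis
    unfolding pairing_J_disk[OF assms] disk_height_def by simp
qed

lemma disk_height_eq:
  assumes "w \<in> poincare_disk"
  shows "disk_height R w = 2 * R / (1 - (cmod w)\<^sup>2) - R"
proof -
  have "(cmod w)\<^sup>2 < 1" using assms by (simp add: poincare_disk_def abs_square_less_1)
  then show ?thesis by (simp add: disk_height_def field_simps)
qed

lemma partition_function_disk:
  assumes "lorentz_product sp" "orthonormal_frame sp e" and R: "R > 0" and b: "b < 0"
  shows "partition_function sp (liouville_disk R) (J_disk sp e R) (b *\<^sub>R e $ 3)
    = 2 * pi * exp (- \<bar>b\<bar> * R) / \<bar>b\<bar>"
proof -
  have "partition_function sp (liouville_disk R) (J_disk sp e R) (b *\<^sub>R e $ 3)
      = (LINT w|liouville_disk R. exp (- \<bar>b\<bar> * disk_height R w))"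
    unfolding partition_function_def using b
    by (intro Bochner_Integration.integral_cong refl)
       (simp add: pairing_J_disk_axis[OF assms(1-3)])
  also have "\<dots> = 2 * pi * exp (- \<bar>b\<bar> * R) / \<bar>b\<bar>"
    using has_bochner_integral_height_exp(1)[OF R, of "\<bar>b\<bar>"] b
    by (intro has_bochner_integral_integral_eq) simp
  finally show ?thesis .
qed

lemma gibbs_density_disk:
  assumes "lorentz_product sp" "orthonormal_frame sp e" and R: "R > 0" and b: "b < 0"
    and w: "w \<in> poincare_disk"
  shows "gibbs_density sp (liouville_disk R) (J_disk sp e R) (b *\<^sub>R e $ 3) w
    = \<bar>b\<bar> / (2 * pi) * exp (\<bar>b\<bar> * R) * exp (- \<bar>b\<bar> * disk_height R w)"
  unfolding gibbs_density_def partition_function_disk[OF assms(1-4)]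
    pairing_J_disk_axis[OF assms(1-3) w]
  using b by (simp add: exp_minus field_simps)

text \<open>Under the density \<open>\<rho>\<close> the height has the exponential law of rate \<open>k\<close> shifted by \<open>R\<close>.\<close>

lemma has_bochner_integral_gibbs_height:
  assumes R: "R > 0" and k: "k > 0"
  defines "\<rho> \<equiv> \<lambda>w. k / (2 * pi) * exp (k * R) * exp (- k * disk_height R w)"
  shows "has_bochner_integral (liouville_disk R) \<rho> 1"
    and "has_bochner_integral (liouville_disk R) (\<lambda>w. \<rho> w * disk_height R w) (R + 1 / k)"
proof -
  have e: "exp (k * R) * exp (- k * R) = 1" by (simp flip: exp_add)
  have "k / (2 * pi) * exp (k * R) * (2 * pi * exp (- k * R) / k) = exp (k * R) * exp (- k * R)"
    using k by simp
  then show "has_bochner_integral (liouville_disk R) \<rho> 1"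
    using has_bochner_integral_mult_right[OF has_bochner_integral_height_exp(1)[OF R k],
      of "k / (2 * pi) * exp (k * R)"] unfolding e \<rho>_def by simp
  have "k / (2 * pi) * exp (k * R) * (2 * pi * (R + 1 / k) * exp (- k * R) / k)
      = (R + 1 / k) * (exp (k * R) * exp (- k * R))"
    using k by simp
  then show "has_bochner_integral (liouville_disk R) (\<lambda>w. \<rho> w * disk_height R w) (R + 1 / k)"
    using has_bochner_integral_mult_right[OF has_bochner_integral_height_exp(2)[OF R k],
      of "k / (2 * pi) * exp (k * R)"] unfolding e \<rho>_def by (simp add: mult_ac)
qed

text \<open>The coordinates along \<open>e\<^sub>1\<close> and \<open>e\<^sub>2\<close> are odd in \<open>w\<close>, so that only the mean height remains; they are bounded
  by the height, which makes them integrable.\<close>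

lemma has_bochner_integral_gibbs_J_disk:
  fixes sp :: "'f::euclidean_space \<Rightarrow> 'f \<Rightarrow> real"
  assumes "lorentz_product sp" "orthonormal_frame sp e" and R: "R > 0" and k: "k > 0"
  defines "\<rho> \<equiv> \<lambda>w. k / (2 * pi) * exp (k * R) * exp (- k * disk_height R w)"
  shows "has_bochner_integral (liouville_disk R) (\<lambda>w. \<rho> w *\<^sub>R J_disk sp e R w) ((R + 1 / k) *\<^sub>R e $ 3)"
proof -
  let ?L = "liouville_disk R"
  have hb: "has_bochner_integral ?L (\<lambda>w. \<rho> w * disk_height R w) (R + 1 / k)"
    unfolding \<rho>_def by (rule has_bochner_integral_gibbs_height(2)[OF R k])
  have \<rho>: "\<rho> w > 0" for w using k by (simp add: \<rho>_def)
  have [measurable]: "\<rho> \<in> borel_measurable borel" unfolding \<rho>_def by measurable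
  define X where "X p w = 2 * R / (1 - (cmod w)\<^sup>2) * p w" for p :: "complex \<Rightarrow> real" and w
  have odd: "has_bochner_integral ?L (\<lambda>w. \<rho> w * X p w) 0"
    if [measurable]: "p \<in> borel_measurable borel" and p: "\<And>w. p (- w) = - p w" "\<And>w. \<bar>p w\<bar> \<le> cmod w" for p
  proof -
    have m [measurable]: "(\<lambda>w. \<rho> w * X p w) \<in> borel_measurable borel" unfolding X_def by measurable
    have "integrable ?L (\<lambda>w. \<rho> w * X p w)"
    proof (rule Bochner_Integration.integrable_bound)
      show "integrable ?L (\<lambda>w. \<rho> w * disk_height R w)" using hb by (rule integrable.intros)
      show "(\<lambda>w. \<rho> w * X p w) \<in> borel_measurable ?L" using m by (rule measurable_liouville_disk)
      show "AE w in ?L. norm (\<rho> w * X p w) \<le> norm (\<rho> w * disk_height R w)"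
      proof (rule AE_I2)
        fix w assume "w \<in> space ?L"
        then have w: "w \<in> poincare_disk" by simp
        then have n: "(cmod w)\<^sup>2 < 1" by (simp add: poincare_disk_def abs_square_less_1)
        have "2 * \<bar>p w\<bar> \<le> 1 + (cmod w)\<^sup>2"
          using p(2)[of w] sum_squares_bound[of 1 "cmod w"] by simp
        then have "R / (1 - (cmod w)\<^sup>2) * (2 * \<bar>p w\<bar>) \<le> R / (1 - (cmod w)\<^sup>2) * (1 + (cmod w)\<^sup>2)"
          using R n by (intro mult_left_mono) auto
        moreover have "\<bar>X p w\<bar> = R / (1 - (cmod w)\<^sup>2) * (2 * \<bar>p w\<bar>)"
          using R n by (simp add: X_def abs_mult)
        ultimately have "\<bar>X p w\<bar> \<le> disk_height R w"
          by (simp add: disk_height_def)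
        then have "\<bar>X p w\<bar> \<le> \<bar>disk_height R w\<bar>" by linarith
        then show "norm (\<rho> w * X p w) \<le> norm (\<rho> w * disk_height R w)"
          using \<rho>[of w] by (simp add: abs_mult)
      qed
    qed
    moreover have "(LINT w|?L. \<rho> w * X p w) = 0"
      using m by (rule integral_liouville_disk_odd) (simp add: X_def p \<rho>_def disk_height_def)
    ultimately show ?thesis by (simp add: has_bochner_integral_iff)
  qed
  have "has_bochner_integral ?L (\<lambda>w. (\<rho> w * X Re w) *\<^sub>R e $ 1 + (\<rho> w * X Im w) *\<^sub>R e $ 2
      + (\<rho> w * disk_height R w) *\<^sub>R e $ 3) (0 *\<^sub>R e $ 1 + 0 *\<^sub>R e $ 2 + (R + 1 / k) *\<^sub>R e $ 3)"
    by (intro has_bochner_integral_add has_bochner_integral_scaleR_left odd hb)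
       (auto simp: abs_Re_le_cmod abs_Im_le_cmod)
  moreover have "\<rho> w *\<^sub>R J_disk sp e R w = (\<rho> w * X Re w) *\<^sub>R e $ 1 + (\<rho> w * X Im w) *\<^sub>R e $ 2
      + (\<rho> w * disk_height R w) *\<^sub>R e $ 3" if "w \<in> space ?L" for w
    using that by (simp add: J_disk_eq(1)[OF assms(1-3)] X_def disk_height_def scaleR_add_right mult_ac)
  ultimately show ?thesis
    by (subst has_bochner_integral_cong[OF refl _ refl]) auto
qed

lemma gibbs_state_disk_polar:
  assumes "lorentz_product sp" "orthonormal_frame sp e" and R: "R > 0" and b: "b < 0"
  shows "gibbs_state sp (liouville_disk R) (J_disk sp e R) (b *\<^sub>R e $ 3) =
    density polar_measure (\<lambda>w. ennreal (2 * R * \<bar>b\<bar> * cmod w / (pi * (1 - (cmod w)\<^sup>2)\<^sup>2) *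
      exp (2 * R * \<bar>b\<bar> - 2 * R * \<bar>b\<bar> / (1 - (cmod w)\<^sup>2))))"
proof -
  define \<rho> where "\<rho> w = \<bar>b\<bar> / (2 * pi) * exp (\<bar>b\<bar> * R) * exp (- \<bar>b\<bar> * disk_height R w)" for w
  have [measurable]: "\<rho> \<in> borel_measurable borel" unfolding \<rho>_def by measurable
  have sp [simp]: "space polar_measure = poincare_disk"
    by (simp add: polar_measure_def space_restrict_space)
  have mp: "f \<in> borel_measurable polar_measure" if "f \<in> borel_measurable borel" for f :: "complex \<Rightarrow> ennreal"
    using that by (simp add: polar_measure_def measurable_restrict_space1)
  have "gibbs_state sp (liouville_disk R) (J_disk sp e R) (b *\<^sub>R e $ 3)
      = density (liouville_disk R) (\<lambda>w. ennreal (\<rho> w))"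
    unfolding gibbs_state_def \<rho>_def
    by (intro density_cong_space) (simp add: gibbs_density_disk[OF assms])
  also have "\<dots> = density polar_measure
      (\<lambda>w. ennreal (4 * R * cmod w / (1 - (cmod w)\<^sup>2)\<^sup>2) * ennreal (\<rho> w))"
    unfolding liouville_disk_eq_density_polar[OF R]
    by (rule density_density_eq) (auto intro!: mp)
  also have "\<dots> = density polar_measure (\<lambda>w. ennreal (2 * R * \<bar>b\<bar> * cmod w / (pi * (1 - (cmod w)\<^sup>2)\<^sup>2) *
      exp (2 * R * \<bar>b\<bar> - 2 * R * \<bar>b\<bar> / (1 - (cmod w)\<^sup>2))))"
  proof (rule density_cong_space)
    fix w assume "w \<in> space polar_measure"
    then have w: "w \<in> poincare_disk" by simp
    have "exp (\<bar>b\<bar> * R) * exp (- \<bar>b\<bar> * disk_height R w)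
        = exp (2 * R * \<bar>b\<bar> - 2 * R * \<bar>b\<bar> / (1 - (cmod w)\<^sup>2))"
      unfolding disk_height_eq[OF w] exp_add[symmetric] by (simp add: algebra_simps)
    then have "4 * R * cmod w / (1 - (cmod w)\<^sup>2)\<^sup>2 * \<rho> w = 2 * R * \<bar>b\<bar> * cmod w / (pi * (1 - (cmod w)\<^sup>2)\<^sup>2) *
      exp (2 * R * \<bar>b\<bar> - 2 * R * \<bar>b\<bar> / (1 - (cmod w)\<^sup>2))"
      unfolding \<rho>_def by (simp add: mult_ac)
    then show "ennreal (4 * R * cmod w / (1 - (cmod w)\<^sup>2)\<^sup>2) * ennreal (\<rho> w)
      = ennreal (2 * R * \<bar>b\<bar> * cmod w / (pi * (1 - (cmod w)\<^sup>2)\<^sup>2) *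
      exp (2 * R * \<bar>b\<bar> - 2 * R * \<bar>b\<bar> / (1 - (cmod w)\<^sup>2)))"
      using R by (subst ennreal_mult'[symmetric]) auto
  qed
  finally show ?thesis .
qed

section \<open>Generalized temperatures and thermodynamics of the Poincare disk\<close>

theorem mainTheorem3:
  fixes sp :: "'f::euclidean_space \<Rightarrow> 'f \<Rightarrow> real" and Or :: "('f ^ 3) set"
    and Fut :: "'f set" and R :: real
  assumes F: "minkowski_space sp Or Fut"
    and R: "R > 0"
  shows "(\<forall>e. admissible_basis sp Or Fut e \<longrightarrow>
           generalized_temperatures sp (liouville_disk R) (J_disk sp e R) =
             {\<beta>. time_like sp \<beta> \<and> \<beta> \<in> past sp Fut}) \<and>
    (\<forall>e' \<beta>. admissible_basis sp Or Fut e' \<longrightarrow>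
           \<beta> \<in> generalized_temperatures sp (liouville_disk R) (J_disk sp e' R) \<longrightarrow>
           (\<exists>e b. admissible_basis sp Or Fut e \<and> \<beta> = b *\<^sub>R e $ 3 \<and> b < 0)) \<and>
    (\<forall>e \<beta> b. let L = liouville_disk R; J = J_disk sp e R in
           admissible_basis sp Or Fut e \<longrightarrow>
           \<beta> \<in> generalized_temperatures sp L J \<longrightarrow>
           \<beta> = b *\<^sub>R e $ 3 \<longrightarrow> b < 0 \<longrightarrow>
             prob_space (gibbs_state sp L J \<beta>) \<and>
             gibbs_state sp L J \<beta> =
               density polar_measure (\<lambda>w. ennreal
                 (2 * R * \<bar>b\<bar> * cmod w / (pi * (1 - (cmod w)\<^sup>2)\<^sup>2) *
                   exp (2 * R * \<bar>b\<bar> - 2 * R * \<bar>b\<bar> / (1 - (cmod w)\<^sup>2)))) \<and>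
             (\<forall>w\<in>poincare_disk. gibbs_density sp L J \<beta> w =
                \<bar>b\<bar> / (2 * pi) * exp (2 * R * \<bar>b\<bar> - 2 * R * \<bar>b\<bar> / (1 - (cmod w)\<^sup>2))) \<and>
             mnorm sp \<beta> = \<bar>b\<bar> \<and>
             integrable L (\<lambda>w. gibbs_density sp L J \<beta> w *\<^sub>R J w) \<and>
             mean_moment sp L J \<beta> =
               (- (1 + R * mnorm sp \<beta>) / (mnorm sp \<beta>)\<^sup>2) *\<^sub>R \<beta> \<and>
             integrable L (\<lambda>w.
               gibbs_density sp L J \<beta> w * ln (gibbs_density sp L J \<beta> w)) \<and>
             gibbs_entropy sp L J \<beta> = 1 + ln (2 * pi / mnorm sp \<beta>))"
proof (intro conjI allI impI)
  show "generalized_temperatures sp (liouville_disk R) (J_disk sp e R) =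
      {\<beta>. time_like sp \<beta> \<and> \<beta> \<in> past sp Fut}" if "admissible_basis sp Or Fut e" for e
    by (simp add: generalized_temperatures_disk[OF F that R] timelike_past_iff[OF F that])
  show "\<exists>e b. admissible_basis sp Or Fut e \<and> \<beta> = b *\<^sub>R e $ 3 \<and> b < 0"
    if "admissible_basis sp Or Fut e'"
      "\<beta> \<in> generalized_temperatures sp (liouville_disk R) (J_disk sp e' R)" for e' \<beta>
    using that(2) exists_admissible_basis_along[OF F that(1), of \<beta>]
    unfolding generalized_temperatures_disk[OF F that(1) R] by blast
next
  fix e \<beta> b
  let ?L = "liouville_disk R" and ?J = "J_disk sp e R"
  show "let L = ?L; J = ?J in
           admissible_basis sp Or Fut e \<longrightarrow>
           \<beta> \<in> generalized_temperatures sp L J \<longrightarrow>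
           \<beta> = b *\<^sub>R e $ 3 \<longrightarrow> b < 0 \<longrightarrow>
             prob_space (gibbs_state sp L J \<beta>) \<and>
             gibbs_state sp L J \<beta> =
               density polar_measure (\<lambda>w. ennreal
                 (2 * R * \<bar>b\<bar> * cmod w / (pi * (1 - (cmod w)\<^sup>2)\<^sup>2) *
                   exp (2 * R * \<bar>b\<bar> - 2 * R * \<bar>b\<bar> / (1 - (cmod w)\<^sup>2)))) \<and>
             (\<forall>w\<in>poincare_disk. gibbs_density sp L J \<beta> w =
                \<bar>b\<bar> / (2 * pi) * exp (2 * R * \<bar>b\<bar> - 2 * R * \<bar>b\<bar> / (1 - (cmod w)\<^sup>2))) \<and>
             mnorm sp \<beta> = \<bar>b\<bar> \<and>
             integrable L (\<lambda>w. gibbs_density sp L J \<beta> w *\<^sub>R J w) \<and>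
             mean_moment sp L J \<beta> =
               (- (1 + R * mnorm sp \<beta>) / (mnorm sp \<beta>)\<^sup>2) *\<^sub>R \<beta> \<and>
             integrable L (\<lambda>w.
               gibbs_density sp L J \<beta> w * ln (gibbs_density sp L J \<beta> w)) \<and>
             gibbs_entropy sp L J \<beta> = 1 + ln (2 * pi / mnorm sp \<beta>)"
    unfolding Let_def
  proof (intro impI)
    assume e: "admissible_basis sp Or Fut e" and \<beta>: "\<beta> = b *\<^sub>R e $ 3" and b: "b < 0"
    note F' = admissible_basisD(2,3)[OF F e]
    have bl: "bilinear sp" using F'(1) by (simp add: lorentz_product_def)
    define k where "k = \<bar>b\<bar>"
    have k: "k > 0" using b by (simp add: k_def)
    define \<rho> where "\<rho> = (\<lambda>w. k / (2 * pi) * exp (k * R) * exp (- k * disk_height R w))"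
    have \<rho>: "gibbs_density sp ?L ?J \<beta> w = \<rho> w" if "w \<in> poincare_disk" for w
      using gibbs_density_disk[OF F' R b that] by (simp add: \<rho>_def k_def \<beta>)
    have one: "has_bochner_integral ?L \<rho> 1"
      and height: "has_bochner_integral ?L (\<lambda>w. \<rho> w * disk_height R w) (R + 1 / k)"
      and moment: "has_bochner_integral ?L (\<lambda>w. \<rho> w *\<^sub>R ?J w) ((R + 1 / k) *\<^sub>R e $ 3)"
      unfolding \<rho>_def
      by (rule has_bochner_integral_gibbs_height[OF R k] has_bochner_integral_gibbs_J_disk[OF F' R k])+

    have prob: "prob_space (gibbs_state sp ?L ?J \<beta>)"
    proof
      have "emeasure (gibbs_state sp ?L ?J \<beta>) (space (gibbs_state sp ?L ?J \<beta>))
          = emeasure (density ?L (\<lambda>w. ennreal (\<rho> w))) (space ?L)"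
        unfolding gibbs_state_def by (subst density_cong_space[where g = "\<lambda>w. ennreal (\<rho> w)"]) (auto simp: \<rho>)
      also have "\<dots> = (\<integral>\<^sup>+ w. ennreal (\<rho> w) \<partial>?L)"
        using one by (subst emeasure_density)
          (auto simp: has_bochner_integral_iff simp del: space_liouville_disk intro!: nn_integral_cong)
      also have "\<dots> = 1"
        using one k by (subst nn_integral_eq_integral) (auto simp: has_bochner_integral_iff \<rho>_def)
      finally show "emeasure (gibbs_state sp ?L ?J \<beta>) (space (gibbs_state sp ?L ?J \<beta>)) = 1" .
    qed

    have dens: "gibbs_density sp ?L ?J \<beta> w =
        \<bar>b\<bar> / (2 * pi) * exp (2 * R * \<bar>b\<bar> - 2 * R * \<bar>b\<bar> / (1 - (cmod w)\<^sup>2))" if "w \<in> poincare_disk" for w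
    proof -
      have "exp (k * R) * exp (- k * disk_height R w)
          = exp (2 * R * k - 2 * R * k / (1 - (cmod w)\<^sup>2))"
        unfolding disk_height_eq[OF that] exp_add[symmetric] by (simp add: algebra_simps)
      then show ?thesis by (simp add: \<rho>[OF that] \<rho>_def k_def mult.assoc)
    qed

    have norm: "mnorm sp \<beta> = \<bar>b\<bar>"
      using F'(2) by (simp add: mnorm_def \<beta> bilinear_lmul[OF bl] bilinear_rmul[OF bl] orthonormal_frame_def)

    have mean: "has_bochner_integral ?L (\<lambda>w. gibbs_density sp ?L ?J \<beta> w *\<^sub>R ?J w) ((R + 1 / k) *\<^sub>R e $ 3)"
      using moment by (subst has_bochner_integral_cong[OF refl _ refl, where g = "\<lambda>w. \<rho> w *\<^sub>R ?J w"]) (auto simp: \<rho>)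
    have "(R + 1 / k) *\<^sub>R e $ 3 = (- (1 + R * k) / k\<^sup>2) *\<^sub>R \<beta>"
      using b by (simp add: \<beta> k_def power2_eq_square field_simps)
    with mean have mean': "mean_moment sp ?L ?J \<beta> = (- (1 + R * mnorm sp \<beta>) / (mnorm sp \<beta>)\<^sup>2) *\<^sub>R \<beta>"
      by (simp add: mean_moment_def has_bochner_integral_iff norm k_def)

    have "has_bochner_integral ?L (\<lambda>w. (ln (k / (2 * pi)) + k * R) * \<rho> w - k * (\<rho> w * disk_height R w))
        ((ln (k / (2 * pi)) + k * R) * 1 - k * (R + 1 / k))"
      by (intro has_bochner_integral_diff has_bochner_integral_mult_right one height)
    moreover have "\<rho> w * ln (\<rho> w) = (ln (k / (2 * pi)) + k * R) * \<rho> w - k * (\<rho> w * disk_height R w)" for w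
    proof -
      have ln: "ln (\<rho> w) = ln (k / (2 * pi)) + k * R - k * disk_height R w"
        using k by (simp add: \<rho>_def ln_mult ln_div)
      show ?thesis unfolding ln by (simp add: algebra_simps)
    qed
    moreover have "(ln (k / (2 * pi)) + k * R) * 1 - k * (R + 1 / k) = - (1 + ln (2 * pi / k))"
      using k by (simp add: ln_div algebra_simps)
    ultimately have ent: "has_bochner_integral ?L
        (\<lambda>w. gibbs_density sp ?L ?J \<beta> w * ln (gibbs_density sp ?L ?J \<beta> w)) (- (1 + ln (2 * pi / k)))"
      by (subst has_bochner_integral_cong[OF refl _ refl, where g = "\<lambda>w. \<rho> w * ln (\<rho> w)"]) (auto simp: \<rho>)

    show "prob_space (gibbs_state sp ?L ?J \<beta>) \<and>
             gibbs_state sp ?L ?J \<beta> =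
               density polar_measure (\<lambda>w. ennreal
                 (2 * R * \<bar>b\<bar> * cmod w / (pi * (1 - (cmod w)\<^sup>2)\<^sup>2) *
                   exp (2 * R * \<bar>b\<bar> - 2 * R * \<bar>b\<bar> / (1 - (cmod w)\<^sup>2)))) \<and>
             (\<forall>w\<in>poincare_disk. gibbs_density sp ?L ?J \<beta> w =
                \<bar>b\<bar> / (2 * pi) * exp (2 * R * \<bar>b\<bar> - 2 * R * \<bar>b\<bar> / (1 - (cmod w)\<^sup>2))) \<and>
             mnorm sp \<beta> = \<bar>b\<bar> \<and>
             integrable ?L (\<lambda>w. gibbs_density sp ?L ?J \<beta> w *\<^sub>R ?J w) \<and>
             mean_moment sp ?L ?J \<beta> =
               (- (1 + R * mnorm sp \<beta>) / (mnorm sp \<beta>)\<^sup>2) *\<^sub>R \<beta> \<and>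
             integrable ?L (\<lambda>w.
               gibbs_density sp ?L ?J \<beta> w * ln (gibbs_density sp ?L ?J \<beta> w)) \<and>
             gibbs_entropy sp ?L ?J \<beta> = 1 + ln (2 * pi / mnorm sp \<beta>)"
      using gibbs_state_disk_polar[OF F' R b] mean ent
      by (intro conjI ballI prob dens norm mean')
         (auto simp: \<beta>[symmetric] has_bochner_integral_iff gibbs_entropy_def norm k_def)
  qed
qed
end
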